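(* Let $\mathrm{L}:\mathcal{M}_{\mathrm{L}}(\mathbb{R}^d)\to\mathcal{M}(\mathbb{R}^d)$ be a spline-admissible operator with Green's function $\rho_{\mathrm{L}}$, null space $\mathcal{N}_{\mathrm{L}}$ of dimension $N_0$, basis $\{p_n\}_{n=1}^{N_0}$ of $\mathcal{N}_{\mathrm{L}}$, and native space $\mathcal{M}_{\mathrm{L}}(\mathbb{R}^d)=\big(C_{\mathrm{L}}(\mathbb{R}^d)\big)'$. Let $\boldsymbol{\nu}: f\mapsto \boldsymbol{\nu}(f)=\big(\langle \nu_1,f\rangle,\ldots,\langle\nu_M,f\rangle\big)$ be a linear measurement operator $\mathcal{M}_{\mathrm{L}}(\mathbb{R}^d)\to\mathbb{R}^M$ that is weak*-continuous on $\mathcal{M}_{\mathrm{L}}(\mathbb{R}^d)=\big(C_{\mathrm{L}}(\mathbb{R}^d)\big)'$. Assume that for any $q_1,q_2\in\mathcal{N}_{\mathrm{L}}$, $\boldsymbol{\nu}(q_1)=\boldsymbol{\nu}(q_2)\Leftrightarrow q_1=q_2$. Let $\mathbf{y}\in\mathbb{R}^M$ be such that the generalized interpolation problem $$\arg\min_{f\in\mathcal{M}_{\mathrm{L}}(\mathbb{R}^d)}\|\mathrm{L}f\|_{\mathcal{M}}\quad\text{s.t.}\quad\boldsymbol{\nu}(f)=\mathbf{y}$$ is feasible (i.e., $\boldsymbol{\nu}(f)=\mathbf{y}$ for some $f\in\mathcal{M}_{\mathrm{L}}(\mathbb{R}^d)$). Then the extremal points of (the solution set of) this problem are nonuniform $\mathrm{L}$-splines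 of the form $$s(\boldsymbol{x})=\sum_{k=1}^K a_k\,\rho_{\mathrm{L}}(\boldsymbol{x}-\boldsymbol{x}_k)+\sum_{n=1}^{N_0}b_n\,p_n(\boldsymbol{x})$$ with $K\le M-N_0$, $\boldsymbol{x}_k\in\mathbb{R}^d$ for $k=1,\ldots,K$, $(a_1,\ldots,a_K)\in\mathbb{R}^K$ and $(b_1,\ldots,b_{N_0})\in\mathbb{R}^{N_0}$.
   Context: Spaces. $\mathcal{S}(\mathbb{R}^d)$ is the Schwartz space and $\mathcal{S}'(\mathbb{R}^d)$ the space of tempered distributions. $C_0(\mathbb{R}^d)$ is the Banach space of continuous functions vanishing at infinity with the supremum norm. $\mathcal{M}(\mathbb{R}^d)=\big(C_0(\mathbb{R}^d)\big)'$ is the space of regular, real-valued, countably additive Borel measures, identified with $\{w\in\mathcal{S}'(\mathbb{R}^d):\|w\|_{\mathcal{M}}<\infty\}$, where $\|w\|_{\mathcal{M}}=\sup_{\varphi\in\mathcal{S}(\mathbb{R}^d):\|\varphi\|_\infty=1}\langle w,\varphi\rangle$ (total variation norm). For $\alpha\in\mathbb{R}$, $L_{\infty,\alpha}(\mathbb{R}^d)$ is the Banach space of functions $f:\mathbb{R}^d\to\mathbb{R}$ with $\|f\|_{\infty,\alpha}=\operatorname{ess\,sup}_{\boldsymbol{x}}|f(\boldsymbol{x})|(1+\|\boldsymbol{x}\|)^{-\alpha}<\infty$. Spline-admissible operator. A linear operator $\mathrm{L}:\mathcal{M}_{\mathrm{L}}(\mathbb{R}^d)\to\mathcal{M}(\mathbb{R}^d)$,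 where $\mathcal{M}_{\mathrm{L}}(\mathbb{R}^d)\supset\mathcal{S}(\mathbb{R}^d)$ is an appropriate subspace of $\mathcal{S}'(\mathbb{R}^d)$, is spline-admissible if (1) it is shift-invariant, i.e., $\mathrm{L}\{s(\cdot-\boldsymbol{x}_0)\}=\mathrm{L}\{s\}(\cdot-\boldsymbol{x}_0)$ for all admissible $s$ and all $\boldsymbol{x}_0\in\mathbb{R}^d$; (2) there is a function $\rho_{\mathrm{L}}:\mathbb{R}^d\to\mathbb{R}$ of slow growth (Green's function) with $\mathrm{L}\{\rho_{\mathrm{L}}\}=\delta$ (Dirac impulse); set $n_0=\inf\{n\in\mathbb{N}:\rho_{\mathrm{L}}\in L_{\infty,n}(\mathbb{R}^d)\}$; (3) the growth-restricted null space $\mathcal{N}_{\mathrm{L}}=\{q\in L_{\infty,n_0}(\mathbb{R}^d):\mathrm{L}\{q\}=0\}$ has finite dimension $N_0\ge0$. The native space is then specified as $\mathcal{M}_{\mathrm{L}}(\mathbb{R}^d)=\{f\in L_{\infty,n_0}(\mathbb{R}^d):\|\mathrm{L}f\|_{\mathcal{M}}<\infty\}$. Predual. A biorthogonal system for $\mathcal{N}_{\mathrm{L}}$ is a pair $(\boldsymbol{\phi},\boldsymbol{p})=(\phi_n,p_n)_{n=1}^{N_0}$ where $\{p_n\}$ is a basis of $\mathcal{N}_{\mathrm{L}}$ and the boundary functionals $\phi_n\in\mathcal{N}_{\mathrm{L}}'$ (also acting as linear functionals on $\mathcal{M}_{\mathrm{L}}(\mathbb{R}^d)$) satisfy $\langle\phi_m,p_n\rangle=\delta_{m,n}$;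 write $\boldsymbol{\phi}(f)=(\langle\phi_1,f\rangle,\ldots,\langle\phi_{N_0},f\rangle)$ and similarly $\boldsymbol{p}(f)$. The operator $\mathrm{L}_{\boldsymbol{\phi}}^{-1}$ is the right inverse of $\mathrm{L}$ on $\mathcal{M}(\mathbb{R}^d)$ with $\boldsymbol{\phi}(\mathrm{L}_{\boldsymbol{\phi}}^{-1}w)=\boldsymbol{0}$ for all $w$; its kernel is $g_{\boldsymbol{\phi}}(\boldsymbol{x},\boldsymbol{y})=\rho_{\mathrm{L}}(\boldsymbol{x}-\boldsymbol{y})-\sum_{n=1}^{N_0}p_n(\boldsymbol{x})q_n(\boldsymbol{y})$ with $q_n(\boldsymbol{y})=\langle\phi_n,\rho_{\mathrm{L}}(\cdot-\boldsymbol{y})\rangle$. With $\mathrm{L}^*$ the adjoint of $\mathrm{L}$ and $\mathrm{L}_{\boldsymbol{\phi}}^{-1*}$ the adjoint of $\mathrm{L}_{\boldsymbol{\phi}}^{-1}$, let $C_{\mathrm{L},\boldsymbol{p}}(\mathbb{R}^d)=\mathrm{L}^*\big(C_0(\mathbb{R}^d)\big)$, $\mathcal{N}_{\mathrm{L}}'=\mathrm{span}\{\phi_n\}_{n=1}^{N_0}$ and $C_{\mathrm{L}}(\mathbb{R}^d)=C_{\mathrm{L},\boldsymbol{p}}(\mathbb{R}^d)\oplus\mathcal{N}_{\mathrm{L}}'$, with norm $\|f\|'_{\mathrm{L},\boldsymbol{\phi}}=\|\mathrm{L}_{\boldsymbol{\phi}}^{-1*}f\|_\infty+\|\boldsymbol{p}(f)\|_2$.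 One has $\mathcal{M}_{\mathrm{L}}(\mathbb{R}^d)=\big(C_{\mathrm{L}}(\mathbb{R}^d)\big)'$; weak*-continuity of $\boldsymbol{\nu}$ is equivalent to $\nu_m\in C_{\mathrm{L}}(\mathbb{R}^d)$ for $m=1,\ldots,M$. Nonuniform $\mathrm{L}$-spline. A function $s:\mathbb{R}^d\to\mathbb{R}$ of slow growth (i.e., $s\in L_{\infty,n_0}(\mathbb{R}^d)$) with $\mathrm{L}\{s\}=\sum_k a_k\delta(\cdot-\boldsymbol{x}_k)$ for a sequence of weights $(a_k)$ and knots $\{\boldsymbol{x}_k\}$. *)

theory Defs
  imports "HOL-Analysis.Analysis" "HOL-Probability.Essential_Supremum"
begin

section \<open>Schwartz functions\<close>

text \<open>A multi-index is given by the list of coordinates along which one differentiates.\<close>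

fun iter_partial :: "'d::finite list \<Rightarrow> (real^'d \<Rightarrow> real) \<Rightarrow> (real^'d \<Rightarrow> real)" where
  "iter_partial [] f = f"
| "iter_partial (i # is) f = (\<lambda>x. frechet_derivative (iter_partial is f) (at x) (axis i 1))"

definition smooth :: "(real^'d::finite \<Rightarrow> real) \<Rightarrow> bool" where
  "smooth f \<longleftrightarrow> (\<forall>is x. iter_partial is f differentiable (at x))"

definition schwartz_function :: "(real^'d::finite \<Rightarrow> real) \<Rightarrow> bool" where
  "schwartz_function f \<longleftrightarrow> smooth f \<and>
     (\<forall>is k. bounded (range (\<lambda>x. (1 + norm x) ^ k * iter_partial is f x)))"

lemma iter_partial_zero: "iter_partial is (\<lambda>x::real^'d::finite. 0) = (\<lambda>x. 0)"
  by (induction "is") auto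

lemma iter_partial_add:
  assumes "smooth f" "smooth g"
  shows "iter_partial is (\<lambda>x. f x + g x) = (\<lambda>x. iter_partial is f x + iter_partial is g x)"
proof (induction "is")
  case (Cons i "is")
  have "frechet_derivative (\<lambda>x. iter_partial is f x + iter_partial is g x) (at x) =
        (\<lambda>h. frechet_derivative (iter_partial is f) (at x) h
           + frechet_derivative (iter_partial is g) (at x) h)" for x
    using assms unfolding smooth_def
    by (intro frechet_derivative_at[symmetric] has_derivative_add)
       (auto simp: frechet_derivative_works)
  then show ?case by (simp add: Cons)
qed simp

lemma iter_partial_scale:
  assumes "smooth f"
  shows "iter_partial is (\<lambda>x. c * f x) = (\<lambda>x. c * iter_partial is f x)"
proof (induction "is")
  case (Cons i "is")
  have "frechet_derivative (\<lambda>x. c * iter_partial is f x) (at x) =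
        (\<lambda>h. c * frechet_derivative (iter_partial is f) (at x) h)" for x
    using assms unfolding smooth_def
    by (intro frechet_derivative_at[symmetric] has_derivative_mult_right)
       (auto simp: frechet_derivative_works)
  then show ?case by (simp add: Cons)
qed simp

lemma iter_partial_shift:
  assumes "smooth f"
  shows "iter_partial is (\<lambda>x. f (x + a)) = (\<lambda>x. iter_partial is f (x + a))"
proof (induction "is")
  case (Cons i "is")
  have "frechet_derivative (\<lambda>x. iter_partial is f (x + a)) (at x) =
        frechet_derivative (iter_partial is f) (at (x + a))" for x
  proof (rule frechet_derivative_at[symmetric])
    have 1: "((\<lambda>x. x + a) has_derivative (\<lambda>h. h)) (at x)"
      by (auto intro!: derivative_eq_intros)
    have 2: "(iter_partial is f has_derivative
              frechet_derivative (iter_partial is f) (at (x + a))) (at (x + a))"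
      using assms by (simp add: smooth_def flip: frechet_derivative_works)
    show "((\<lambda>x. iter_partial is f (x + a)) has_derivative
           frechet_derivative (iter_partial is f) (at (x + a))) (at x)"
      using has_derivative_compose[OF 1 2] by simp
  qed
  then show ?case by (simp add: Cons)
qed simp

lemma schwartz_function_zero: "schwartz_function (\<lambda>x. 0)"
  by (auto simp: schwartz_function_def smooth_def iter_partial_zero)

lemma schwartz_function_add:
  assumes "schwartz_function f" "schwartz_function g"
  shows "schwartz_function (\<lambda>x. f x + g x)"
  using assms
  by (auto simp: schwartz_function_def smooth_def iter_partial_add[unfolded smooth_def]
           distrib_left intro!: bounded_plus_comp)

lemma schwartz_function_scale:
  assumes "schwartz_function f"
  shows "schwartz_function (\<lambda>x. c * f x)"
proof -
  have sm: "smooth f" using assms by (simp add: schwartz_function_def)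
  have "bounded (range (\<lambda>x. (1 + norm x) ^ k * (c * iter_partial is f x)))" for k "is"
  proof -
    have "bounded (range (\<lambda>x. (1 + norm x) ^ k * iter_partial is f x))"
      using assms by (simp add: schwartz_function_def)
    then have "bounded ((\<lambda>y. c *\<^sub>R y) ` range (\<lambda>x. (1 + norm x) ^ k * iter_partial is f x))"
      by (rule bounded_scaling)
    then show ?thesis by (simp add: image_image mult.left_commute)
  qed
  then show ?thesis
    using sm by (simp add: schwartz_function_def smooth_def iter_partial_scale[OF sm])
qed

lemma one_plus_norm_shift:
  fixes x a :: "'a::real_normed_vector"
  shows "(1 + norm x) ^ k \<le> (1 + norm a) ^ k * (1 + norm (x + a)) ^ k"
proof -
  have "norm x \<le> norm (x + a) + norm a"
    using norm_triangle_ineq4[of "x + a" a] by simp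
  then have "1 + norm x \<le> (1 + norm a) * (1 + norm (x + a))"
    using mult_nonneg_nonneg[OF norm_ge_zero[of a] norm_ge_zero[of "x + a"]]
    unfolding distrib_left distrib_right by linarith
  then show ?thesis
    unfolding power_mult_distrib[symmetric] by (intro power_mono) auto
qed

lemma schwartz_function_shift:
  assumes "schwartz_function f"
  shows "schwartz_function (\<lambda>x. f (x + a))"
proof -
  have sm: "smooth f" using assms by (simp add: schwartz_function_def)
  have "bounded (range (\<lambda>x. (1 + norm x) ^ k * iter_partial is f (x + a)))" for k "is"
  proof -
    obtain B where B: "\<And>x. \<bar>(1 + norm x) ^ k * iter_partial is f x\<bar> \<le> B"
      using assms unfolding schwartz_function_def bounded_iff real_norm_def by blast
    have "\<bar>(1 + norm x) ^ k * iter_partial is f (x + a)\<bar> \<le> (1 + norm a) ^ k * B" for x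
    proof -
      have "\<bar>(1 + norm x) ^ k * iter_partial is f (x + a)\<bar>
            \<le> (1 + norm a) ^ k * (1 + norm (x + a)) ^ k * \<bar>iter_partial is f (x + a)\<bar>"
        using one_plus_norm_shift[of x k a] by (simp add: abs_mult mult_right_mono)
      also have "\<dots> = (1 + norm a) ^ k * \<bar>(1 + norm (x + a)) ^ k * iter_partial is f (x + a)\<bar>"
        by (simp add: abs_mult)
      also have "\<dots> \<le> (1 + norm a) ^ k * B"
        using B[of "x + a"] by (intro mult_left_mono) auto
      finally show ?thesis .
    qed
    then show ?thesis by (auto simp: bounded_iff)
  qed
  moreover have "iter_partial is (\<lambda>x. f (x + a)) differentiable (at x)" for "is" x
  proof -
    have 1: "((\<lambda>x. x + a) has_derivative (\<lambda>h. h)) (at x)"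
      by (auto intro!: derivative_eq_intros)
    obtain D where "(iter_partial is f has_derivative D) (at (x + a))"
      using sm by (auto simp: smooth_def differentiable_def)
    from has_derivative_compose[OF 1 this] show ?thesis
      by (auto simp: iter_partial_shift[OF sm] differentiable_def)
  qed
  ultimately show ?thesis
    by (simp add: schwartz_function_def smooth_def iter_partial_shift[OF sm])
qed

typedef 'd schwartz = "{f :: real^'d::finite \<Rightarrow> real. schwartz_function f}"
  morphisms schwartz_fun Abs_schwartz
  using schwartz_function_zero by blast

setup_lifting type_definition_schwartz

instantiation schwartz :: (finite) real_vector
begin

lift_definition zero_schwartz :: "'a schwartz" is "\<lambda>x. 0"
  by (rule schwartz_function_zero)
lift_definition plus_schwartz :: "'a schwartz \<Rightarrow> 'a schwartz \<Rightarrow> 'a schwartz"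
  is "\<lambda>f g x. f x + g x" by (rule schwartz_function_add)
lift_definition scaleR_schwartz :: "real \<Rightarrow> 'a schwartz \<Rightarrow> 'a schwartz"
  is "\<lambda>c f x. c * f x" by (rule schwartz_function_scale)
lift_definition uminus_schwartz :: "'a schwartz \<Rightarrow> 'a schwartz"
  is "\<lambda>f x. - f x" using schwartz_function_scale[of _ "-1"] by simp
lift_definition minus_schwartz :: "'a schwartz \<Rightarrow> 'a schwartz \<Rightarrow> 'a schwartz"
  is "\<lambda>f g x. f x - g x"
  using schwartz_function_add[OF _ schwartz_function_scale[of _ "-1"]] by simp

instance
  by standard (transfer; simp add: fun_eq_iff algebra_simps)+

end

lift_definition schwartz_shift :: "real^'d::finite \<Rightarrow> 'd schwartz \<Rightarrow> 'd schwartz"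
  is "\<lambda>a f x. f (x + a)" by (rule schwartz_function_shift)

definition sup_norm :: "(real^'d::finite \<Rightarrow> real) \<Rightarrow> real" where
  "sup_norm f = (SUP x. \<bar>f x\<bar>)"

definition schwartz_norm :: "nat \<Rightarrow> 'd::finite schwartz \<Rightarrow> real" where
  "schwartz_norm N \<phi> =
     (\<Sum>is | length is \<le> N. SUP x. (1 + norm x) ^ N * \<bar>iter_partial is (schwartz_fun \<phi>) x\<bar>)"

section \<open>Tempered distributions\<close>

definition tempered_functional :: "('d::finite schwartz \<Rightarrow> real) \<Rightarrow> bool" where
  "tempered_functional u \<longleftrightarrow> linear u \<and> (\<exists>C N. \<forall>\<phi>. \<bar>u \<phi>\<bar> \<le> C * schwartz_norm N \<phi>)"

lemma finite_multi_indices: "finite {is :: 'd::finite list. length is \<le> N}"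
  using finite_lists_length_le[of "UNIV :: 'd set" N] by simp

lemma schwartz_norm_bdd:
  "bdd_above (range (\<lambda>x. (1 + norm x) ^ N * \<bar>iter_partial is (schwartz_fun \<phi>) x\<bar>))"
proof -
  have "bounded (range (\<lambda>x. (1 + norm x) ^ N * iter_partial is (schwartz_fun \<phi>) x))"
    using schwartz_fun[of \<phi>] by (simp add: schwartz_function_def)
  then obtain B where "\<And>x. \<bar>(1 + norm x) ^ N * iter_partial is (schwartz_fun \<phi>) x\<bar> \<le> B"
    by (auto simp: bounded_iff)
  then show ?thesis by (intro bdd_aboveI[of _ B]) (auto simp: abs_mult)
qed

lemma schwartz_norm_term_nonneg:
  "0 \<le> (SUP x. (1 + norm x) ^ N * \<bar>iter_partial is (schwartz_fun \<phi>) x\<bar>)"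
  by (rule cSUP_upper2[OF schwartz_norm_bdd, of 0]) auto

lemma schwartz_norm_nonneg: "0 \<le> schwartz_norm N \<phi>"
  unfolding schwartz_norm_def by (intro sum_nonneg schwartz_norm_term_nonneg)

lemma schwartz_norm_mono:
  assumes "M \<le> N"
  shows "schwartz_norm M \<phi> \<le> schwartz_norm N \<phi>"
proof -
  have "schwartz_norm M \<phi> \<le>
      (\<Sum>is | length is \<le> M. SUP x. (1 + norm x) ^ N * \<bar>iter_partial is (schwartz_fun \<phi>) x\<bar>)"
    unfolding schwartz_norm_def
    using assms
    by (intro sum_mono cSUP_mono schwartz_norm_bdd)
       (auto intro!: exI mult_right_mono power_increasing)
  also have "\<dots> \<le> schwartz_norm N \<phi>"
    unfolding schwartz_norm_def using assms
    by (intro sum_mono2 finite_multi_indices schwartz_norm_term_nonneg) auto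
  finally show ?thesis .
qed

lemma schwartz_norm_shift:
  "schwartz_norm N (schwartz_shift a \<phi>) \<le> (1 + norm a) ^ N * schwartz_norm N \<phi>"
  unfolding schwartz_norm_def sum_distrib_left
proof (rule sum_mono)
  fix "is" :: "'a list"
  have sm: "smooth (schwartz_fun \<phi>)"
    using schwartz_fun[of \<phi>] by (simp add: schwartz_function_def)
  let ?S = "SUP x. (1 + norm x) ^ N * \<bar>iter_partial is (schwartz_fun \<phi>) x\<bar>"
  have "(1 + norm x) ^ N * \<bar>iter_partial is (schwartz_fun \<phi>) (x + a)\<bar> \<le> (1 + norm a) ^ N * ?S"
    for x
  proof -
    have "(1 + norm x) ^ N * \<bar>iter_partial is (schwartz_fun \<phi>) (x + a)\<bar>
        \<le> (1 + norm a) ^ N * ((1 + norm (x + a)) ^ N * \<bar>iter_partial is (schwartz_fun \<phi>) (x + a)\<bar>)"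
      using one_plus_norm_shift[of x N a]
      by (simp add: mult_right_mono flip: mult.assoc)
    also have "\<dots> \<le> (1 + norm a) ^ N * ?S"
      by (intro mult_left_mono cSUP_upper schwartz_norm_bdd) auto
    finally show ?thesis .
  qed
  then show "(SUP x. (1 + norm x) ^ N * \<bar>iter_partial is (schwartz_fun (schwartz_shift a \<phi>)) x\<bar>)
      \<le> (1 + norm a) ^ N * ?S"
    by (intro cSUP_least) (auto simp: schwartz_shift.rep_eq iter_partial_shift[OF sm])
qed

lemma tempered_functional_zero: "tempered_functional (\<lambda>\<phi>. 0)"
  by (auto simp: tempered_functional_def linear_iff intro!: exI[of _ 0])

lemma tempered_functional_add:
  assumes "tempered_functional u" "tempered_functional v"
  shows "tempered_functional (\<lambda>\<phi>. u \<phi> + v \<phi>)"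
proof -
  obtain C M where 1: "\<And>\<phi>. \<bar>u \<phi>\<bar> \<le> C * schwartz_norm M \<phi>"
    using assms(1) by (auto simp: tempered_functional_def)
  obtain D N where 2: "\<And>\<phi>. \<bar>v \<phi>\<bar> \<le> D * schwartz_norm N \<phi>"
    using assms(2) by (auto simp: tempered_functional_def)
  have "\<bar>u \<phi> + v \<phi>\<bar> \<le> (\<bar>C\<bar> + \<bar>D\<bar>) * schwartz_norm (max M N) \<phi>" for \<phi>
  proof -
    have "C * schwartz_norm M \<phi> \<le> \<bar>C\<bar> * schwartz_norm (max M N) \<phi>"
      by (intro mult_mono schwartz_norm_mono schwartz_norm_nonneg) auto
    moreover have "D * schwartz_norm N \<phi> \<le> \<bar>D\<bar> * schwartz_norm (max M N) \<phi>"
      by (intro mult_mono schwartz_norm_mono schwartz_norm_nonneg) auto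
    ultimately show ?thesis using 1[of \<phi>] 2[of \<phi>] abs_triangle_ineq[of "u \<phi>" "v \<phi>"]
      unfolding distrib_right by linarith
  qed
  then show ?thesis
    using assms by (auto simp: tempered_functional_def intro: linear_compose_add)
qed

lemma tempered_functional_scale:
  assumes "tempered_functional u"
  shows "tempered_functional (\<lambda>\<phi>. c * u \<phi>)"
proof -
  obtain C M where 1: "\<And>\<phi>. \<bar>u \<phi>\<bar> \<le> C * schwartz_norm M \<phi>"
    using assms(1) by (auto simp: tempered_functional_def)
  have "\<bar>c * u \<phi>\<bar> \<le> (\<bar>c\<bar> * C) * schwartz_norm M \<phi>" for \<phi>
    using 1[of \<phi>] by (simp add: abs_mult mult.assoc mult_left_mono)
  moreover have "linear (\<lambda>\<phi>. c * u \<phi>)"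
    using assms by (auto simp: tempered_functional_def linear_iff algebra_simps)
  ultimately show ?thesis by (auto simp: tempered_functional_def)
qed

lemma tempered_functional_shift:
  assumes "tempered_functional u"
  shows "tempered_functional (\<lambda>\<phi>. u (schwartz_shift a \<phi>))"
proof -
  obtain C M where 1: "\<And>\<phi>. \<bar>u \<phi>\<bar> \<le> C * schwartz_norm M \<phi>"
    using assms(1) by (auto simp: tempered_functional_def)
  have "\<bar>u (schwartz_shift a \<phi>)\<bar> \<le> (\<bar>C\<bar> * (1 + norm a) ^ M) * schwartz_norm M \<phi>" for \<phi>
  proof -
    have "\<bar>u (schwartz_shift a \<phi>)\<bar> \<le> \<bar>C\<bar> * schwartz_norm M (schwartz_shift a \<phi>)"
      using 1[of "schwartz_shift a \<phi>"] schwartz_norm_nonneg[of M "schwartz_shift a \<phi>"]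
      by (meson abs_ge_self mult_right_mono order_trans)
    also have "\<dots> \<le> \<bar>C\<bar> * ((1 + norm a) ^ M * schwartz_norm M \<phi>)"
      by (intro mult_left_mono schwartz_norm_shift) auto
    finally show ?thesis by (simp add: mult.assoc)
  qed
  moreover have "schwartz_shift a (\<phi> + \<psi>) = schwartz_shift a \<phi> + schwartz_shift a \<psi>"
    "schwartz_shift a (c *\<^sub>R \<phi>) = c *\<^sub>R schwartz_shift a \<phi>" for \<phi> \<psi> c
    by (transfer; simp)+
  then have "linear (\<lambda>\<phi>. u (schwartz_shift a \<phi>))"
    using assms by (auto simp: tempered_functional_def linear_iff)
  ultimately show ?thesis by (auto simp: tempered_functional_def)
qed

lemma tempered_functional_eval: "tempered_functional (\<lambda>\<phi>. schwartz_fun \<phi> x)"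
proof -
  have "\<bar>schwartz_fun \<phi> x\<bar> \<le> 1 * schwartz_norm 0 \<phi>" for \<phi>
  proof -
    have "{is :: 'a list. length is \<le> 0} = {[]}" by auto
    then show ?thesis
      using cSUP_upper[OF _ schwartz_norm_bdd[of 0 "[]" \<phi>], of x] by (simp add: schwartz_norm_def)
  qed
  then show ?thesis
    unfolding tempered_functional_def
    by (intro conjI exI[of _ 1] exI[of _ 0])
       (auto simp: linear_iff plus_schwartz.rep_eq scaleR_schwartz.rep_eq)
qed

typedef 'd tempered = "{u :: 'd::finite schwartz \<Rightarrow> real. tempered_functional u}"
  morphisms apply_distr Abs_tempered
  using tempered_functional_zero by blast

setup_lifting type_definition_tempered

instantiation tempered :: (finite) real_vector
begin

lift_definition zero_tempered :: "'a tempered" is "\<lambda>\<phi>. 0"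
  by (rule tempered_functional_zero)
lift_definition plus_tempered :: "'a tempered \<Rightarrow> 'a tempered \<Rightarrow> 'a tempered"
  is "\<lambda>u v \<phi>. u \<phi> + v \<phi>" by (rule tempered_functional_add)
lift_definition scaleR_tempered :: "real \<Rightarrow> 'a tempered \<Rightarrow> 'a tempered"
  is "\<lambda>c u \<phi>. c * u \<phi>" by (rule tempered_functional_scale)
lift_definition uminus_tempered :: "'a tempered \<Rightarrow> 'a tempered"
  is "\<lambda>u \<phi>. - u \<phi>" using tempered_functional_scale[of _ "-1"] by simp
lift_definition minus_tempered :: "'a tempered \<Rightarrow> 'a tempered \<Rightarrow> 'a tempered"
  is "\<lambda>u v \<phi>. u \<phi> - v \<phi>"
  using tempered_functional_add[OF _ tempered_functional_scale[of _ "-1"]] by simp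

instance
  by standard (transfer; simp add: fun_eq_iff algebra_simps)+

end

text \<open>\<open>shift a s\<close> is the distribution \<open>s(\<cdot> - a)\<close>; the translation moves to the test function.\<close>

lift_definition shift :: "real^'d::finite \<Rightarrow> 'd tempered \<Rightarrow> 'd tempered"
  is "\<lambda>a u \<phi>. u (schwartz_shift a \<phi>)" by (rule tempered_functional_shift)

lift_definition dirac :: "real^'d::finite \<Rightarrow> 'd tempered"
  is "\<lambda>x \<phi>. schwartz_fun \<phi> x" by (rule tempered_functional_eval)

text \<open>The distribution of a function. It is only meaningful if the integral defines a tempered
  functional; this is the case for all members of the spaces \<open>L_inf \<alpha>\<close> below.\<close>

definition fun_distr :: "(real^'d::finite \<Rightarrow> real) \<Rightarrow> 'd tempered" where
  "fun_distr f = Abs_tempered (\<lambda>\<phi>. LINT x|lebesgue. f x * schwartz_fun \<phi> x)"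

section \<open>Function and measure spaces\<close>

definition L_inf :: "real \<Rightarrow> (real^'d::finite \<Rightarrow> real) set" where
  "L_inf \<alpha> = {f \<in> borel_measurable lebesgue.
     esssup lebesgue (\<lambda>x. ereal (\<bar>f x\<bar> * (1 + norm x) powr (- \<alpha>))) < \<infinity>}"

definition slow_growth :: "(real^'d::finite \<Rightarrow> real) \<Rightarrow> bool" where
  "slow_growth f \<longleftrightarrow> (\<exists>n::nat. f \<in> L_inf (real n))"

definition growth_order :: "(real^'d::finite \<Rightarrow> real) \<Rightarrow> nat" where
  "growth_order f = (LEAST n. f \<in> L_inf (real n))"

definition M_norm :: "'d::finite tempered \<Rightarrow> ereal" where
  "M_norm w = (SUP \<phi> \<in> {\<phi>. sup_norm (schwartz_fun \<phi>) = 1}. ereal (apply_distr w \<phi>))"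

definition M_space :: "'d::finite tempered set" where
  "M_space = {w. M_norm w < \<infinity>}"

definition C0_space :: "(real^'d::finite \<Rightarrow> real) set" where
  "C0_space = {\<psi>. continuous_on UNIV \<psi> \<and> (\<psi> \<longlongrightarrow> 0) at_infinity}"

text \<open>The duality product of a measure with a function vanishing at infinity: the unique extension
  from the (uniformly dense) Schwartz functions that is continuous for the supremum norm.\<close>

definition C0_pairing :: "'d::finite tempered \<Rightarrow> (real^'d \<Rightarrow> real) \<Rightarrow> real" where
  "C0_pairing w \<psi> = (THE c. \<forall>\<phi>. uniform_limit UNIV (\<lambda>n. schwartz_fun (\<phi> n)) \<psi> sequentially \<longrightarrow>
     (\<lambda>n. apply_distr w (\<phi> n)) \<longlonglongrightarrow> c)"

section \<open>Spline-admissible operators\<close>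

definition linear_on_subspace :: "'a::real_vector set \<Rightarrow> ('a \<Rightarrow> 'b::real_vector) \<Rightarrow> bool" where
  "linear_on_subspace V T \<longleftrightarrow> subspace V \<and>
     (\<forall>x\<in>V. \<forall>y\<in>V. T (x + y) = T x + T y) \<and> (\<forall>c. \<forall>x\<in>V. T (c *\<^sub>R x) = c *\<^sub>R T x)"

text \<open>An operator is a map \<open>L\<close> together with the subspace \<open>D\<close> of tempered distributions on which it
  is defined with tempered distributions as values; the native space cuts out the part of \<open>D\<close>
  that has the right growth and is mapped to measures.\<close>

definition native_space ::
  "'d::finite tempered set \<Rightarrow> ('d tempered \<Rightarrow> 'd tempered) \<Rightarrow> (real^'d \<Rightarrow> real) \<Rightarrow> 'd tempered set" where
  "native_space D L \<rho> =
     {f \<in> D. f \<in> fun_distr ` L_inf (real (growth_order \<rho>)) \<and> M_norm (L f) < \<infinity>}"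

definition null_space ::
  "'d::finite tempered set \<Rightarrow> ('d tempered \<Rightarrow> 'd tempered) \<Rightarrow> (real^'d \<Rightarrow> real) \<Rightarrow> 'd tempered set" where
  "null_space D L \<rho> = {q \<in> D. q \<in> fun_distr ` L_inf (real (growth_order \<rho>)) \<and> L q = 0}"

definition spline_admissible ::
  "'d::finite tempered set \<Rightarrow> ('d tempered \<Rightarrow> 'd tempered) \<Rightarrow> (real^'d \<Rightarrow> real) \<Rightarrow> bool" where
  "spline_admissible D L \<rho> \<longleftrightarrow>
     linear_on_subspace D L \<and>
     (\<forall>\<phi>. fun_distr (schwartz_fun \<phi>) \<in> native_space D L \<rho>) \<and>
     (\<forall>s\<in>D. \<forall>x. shift x s \<in> D \<and> L (shift x s) = shift x (L s)) \<and>
     slow_growth \<rho> \<and> fun_distr \<rho> \<in> D \<and> L (fun_distr \<rho>) = dirac 0 \<and>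
     (\<exists>B. finite B \<and> null_space D L \<rho> = span B)"

definition null_space_basis ::
  "'d::finite tempered set \<Rightarrow> ('d tempered \<Rightarrow> 'd tempered) \<Rightarrow> (real^'d \<Rightarrow> real) \<Rightarrow>
   nat \<Rightarrow> (nat \<Rightarrow> real^'d \<Rightarrow> real) \<Rightarrow> bool" where
  "null_space_basis D L \<rho> N0 p \<longleftrightarrow>
     (\<forall>n\<in>{1..N0}. p n \<in> L_inf (real (growth_order \<rho>))) \<and>
     inj_on (\<lambda>n. fun_distr (p n)) {1..N0} \<and>
     independent ((\<lambda>n. fun_distr (p n)) ` {1..N0}) \<and>
     span ((\<lambda>n. fun_distr (p n)) ` {1..N0}) = null_space D L \<rho>"

definition biorthogonal_system ::
  "'d::finite tempered set \<Rightarrow> ('d tempered \<Rightarrow> 'd tempered) \<Rightarrow> (real^'d \<Rightarrow> real) \<Rightarrow>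
   nat \<Rightarrow> (nat \<Rightarrow> 'd tempered \<Rightarrow> real) \<Rightarrow> (nat \<Rightarrow> real^'d \<Rightarrow> real) \<Rightarrow> bool" where
  "biorthogonal_system D L \<rho> N0 \<phi> p \<longleftrightarrow>
     null_space_basis D L \<rho> N0 p \<and>
     (\<forall>m\<in>{1..N0}. linear_on_subspace (native_space D L \<rho>) (\<phi> m)) \<and>
     (\<forall>m\<in>{1..N0}. \<forall>n\<in>{1..N0}. \<phi> m (fun_distr (p n)) = (if m = n then 1 else 0))"

text \<open>The kernel of the right inverse is its response to shifted Dirac impulses. Biorthogonality and
  the three properties below force it to be
  \<open>\<rho>(x - y) - (\<Sum>n. p\<^sub>n(x) q\<^sub>n(y))\<close> with \<open>q\<^sub>n(y) = \<phi>\<^sub>n(\<rho>(\<cdot> - y))\<close>.\<close>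

definition right_inverse ::
  "'d::finite tempered set \<Rightarrow> ('d tempered \<Rightarrow> 'd tempered) \<Rightarrow> (real^'d \<Rightarrow> real) \<Rightarrow>
   nat \<Rightarrow> (nat \<Rightarrow> 'd tempered \<Rightarrow> real) \<Rightarrow> ('d tempered \<Rightarrow> 'd tempered) \<Rightarrow> bool" where
  "right_inverse D L \<rho> N0 \<phi> Linv \<longleftrightarrow>
     linear_on_subspace M_space Linv \<and>
     (\<forall>w\<in>M_space. Linv w \<in> native_space D L \<rho> \<and> L (Linv w) = w \<and>
        (\<forall>n\<in>{1..N0}. \<phi> n (Linv w) = 0))"

section \<open>The predual and the weak* topology\<close>

text \<open>Elements of the predual are represented by the functionals they induce on the native space.
  \<open>adjoint_on_C0 L \<psi>\<close> is the image of \<open>\<psi>\<close> under the adjoint of \<open>L\<close>.\<close>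

definition adjoint_on_C0 ::
  "('d::finite tempered \<Rightarrow> 'd tempered) \<Rightarrow> (real^'d \<Rightarrow> real) \<Rightarrow> 'd tempered \<Rightarrow> real" where
  "adjoint_on_C0 L \<psi> = (\<lambda>f. C0_pairing (L f) \<psi>)"

definition predual ::
  "('d::finite tempered \<Rightarrow> 'd tempered) \<Rightarrow> nat \<Rightarrow> (nat \<Rightarrow> 'd tempered \<Rightarrow> real) \<Rightarrow>
   ('d tempered \<Rightarrow> real) set" where
  "predual L N0 \<phi> =
     {\<lambda>f. adjoint_on_C0 L \<psi> f + (\<Sum>n=1..N0. c n * \<phi> n f) | \<psi> c. \<psi> \<in> C0_space}"

definition weak_star_topology :: "'a set \<Rightarrow> ('a \<Rightarrow> real) set \<Rightarrow> 'a topology" where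
  "weak_star_topology X C = topology_generated_by {{f \<in> X. g f \<in> U} | g U. g \<in> C \<and> open U}"

section \<open>Interpolation problem and splines\<close>

definition interpolation_solutions ::
  "'d::finite tempered set \<Rightarrow> ('d tempered \<Rightarrow> 'd tempered) \<Rightarrow> (real^'d \<Rightarrow> real) \<Rightarrow>
   ('d tempered \<Rightarrow> real^'m::finite) \<Rightarrow> real^'m \<Rightarrow> 'd tempered set" where
  "interpolation_solutions D L \<rho> \<nu> y =
     {f. is_arg_min (\<lambda>f. M_norm (L f)) (\<lambda>f. f \<in> native_space D L \<rho> \<and> \<nu> f = y) f}"

text \<open>The series of weighted Dirac impulses converges in the sense of tempered distributions;
  finitely many knots are covered by weights that vanish eventually.\<close>

definition nonuniform_spline ::
  "'d::finite tempered set \<Rightarrow> ('d tempered \<Rightarrow> 'd tempered) \<Rightarrow> (real^'d \<Rightarrow> real) \<Rightarrow> 'd tempered \<Rightarrow> bool"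
  where
  "nonuniform_spline D L \<rho> s \<longleftrightarrow>
     s \<in> D \<and> s \<in> fun_distr ` L_inf (real (growth_order \<rho>)) \<and>
     (\<exists>(a :: nat \<Rightarrow> real) (x :: nat \<Rightarrow> real^'d).
        \<forall>\<phi>. ((\<lambda>k. a k * schwartz_fun \<phi> (x k)) has_sum apply_distr (L s) \<phi>) UNIV)"

end

theory Submission
  imports Defs "HOL-Probability.Sinc_Integral"
begin

text \<open>
Let \<open>s\<close> be an extreme solution and \<open>w = L s\<close>. Call \<open>u\<close> a fragment of \<open>w\<close> if the norms of
\<open>u\<close> and \<open>w - u\<close> add up to that of \<open>w\<close>. The argument has two halves, one about convexity and one
about measures.

Convexity: along a linear combination of fragments the norm of \<open>w\<close> is affine for small steps of
either sign (\<open>perturbation_by_fragments\<close>). If \<open>k\<close> fragments are given and \<open>k + N0\<close> exceeds the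
number of measurements, some nontrivial combination of their preimages under \<open>L\<close> and of the null
space basis is invisible to the measurements. Moving \<open>s\<close> in this direction, forwards and backwards,
preserves the constraint, and by minimality it preserves the norm as well; extremality forces the
direction to be 0. Hence any such \<open>k\<close> fragments are linearly dependent
(\<open>extreme_point_fragments_relation\<close>), that is, the fragments span a space of dimension at most
\<open>CARD('m) - N0\<close>.

Measures: if the fragments of \<open>w\<close> span a space of dimension at most \<open>m\<close>, then \<open>w\<close> is a
combination of at most \<open>m\<close> Dirac impulses (\<open>sum_of_diracs_if_fragments_dependent\<close>). The products
of \<open>w\<close> with Schwartz functions between 0 and 1 are fragments (\<open>localize_fragment\<close>). Therefore
powers of a single function satisfy a linear relation modulo the annihilator of \<open>w\<close>, and applying
this to functions that separate points yields an annihilator of \<open>w\<close> with finitely many zeros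
(\<open>annihilator_with_finite_zero_set\<close>). A test function that vanishes at these zeros is a uniform
limit of multiples of the annihilator, so \<open>w\<close> vanishes on it
(\<open>apply_eq_0_if_vanishing_on_zeros\<close>). Everything takes place in the algebra of Schwartz functions
with the supremum norm.

Finally, \<open>s\<close> minus the combination of shifted Green's functions with the same weights and knots lies
in the null space.
\<close>

section \<open>The algebra of Schwartz functions\<close>

text \<open>All iterated partial derivatives are covered at once, without formulas for them, by exhibiting a class
of rapidly decreasing functions that contains the function and is stable under partial
differentiation.\<close>

lemma schwartz_function_coinduct:
  fixes A :: "(real^'d::finite \<Rightarrow> real) set"
  assumes "f \<in> A"
    and diff: "\<And>f x. f \<in> A \<Longrightarrow> f differentiable (at x)"
    and partial: "\<And>f i. f \<in> A \<Longrightarrow> (\<lambda>x. frechet_derivative f (at x) (axis i 1)) \<in> A"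
    and decay: "\<And>f k. f \<in> A \<Longrightarrow> bounded (range (\<lambda>x. (1 + norm x) ^ k * f x))"
  shows "schwartz_function f"
proof -
  have "iter_partial is f \<in> A" for "is"
    by (induction "is") (simp_all add: \<open>f \<in> A\<close> partial)
  then show ?thesis
    unfolding schwartz_function_def smooth_def using diff decay by blast
qed

lemma iter_partial_append: "iter_partial (is @ js) f = iter_partial is (iter_partial js f)"
  by (induction "is") auto

lemma schwartz_function_partial:
  assumes "schwartz_function f"
  shows "schwartz_function (\<lambda>x. frechet_derivative f (at x) (axis i 1))"
proof -
  have "iter_partial js (\<lambda>x. frechet_derivative f (at x) (axis i 1)) = iter_partial (js @ [i]) f" for js
    by (simp add: iter_partial_append)
  with assms show ?thesis
    unfolding schwartz_function_def smooth_def by presburger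
qed

lemma schwartz_function_differentiable:
  "schwartz_function f \<Longrightarrow> f differentiable (at x)"
  unfolding schwartz_function_def smooth_def by (metis iter_partial.simps(1))

lemma schwartz_function_decay:
  "schwartz_function f \<Longrightarrow> bounded (range (\<lambda>x. (1 + norm x) ^ k * f x))"
  unfolding schwartz_function_def by (metis iter_partial.simps(1))

text \<open>By the Leibniz rule the derivatives of a product of Schwartz functions are sums of such products, so
the products have to be closed under sums to form a class stable under differentiation.\<close>

inductive_set product_sums :: "(real^'d::finite \<Rightarrow> real) set" where
  prod: "schwartz_function f \<Longrightarrow> schwartz_function g \<Longrightarrow> (\<lambda>x. f x * g x) \<in> product_sums"
| sum: "f \<in> product_sums \<Longrightarrow> g \<in> product_sums \<Longrightarrow> (\<lambda>x. f x + g x) \<in> product_sums"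

lemma product_sums_differentiable: "f \<in> product_sums \<Longrightarrow> f differentiable (at x)"
  by (induction rule: product_sums.induct)
     (auto intro: differentiable_mult differentiable_add schwartz_function_differentiable)

lemma schwartz_function_mult:
  assumes "schwartz_function f" "schwartz_function g"
  shows "schwartz_function (\<lambda>x. f x * g x)"
proof (rule schwartz_function_coinduct[where A = product_sums])
  show "(\<lambda>x. f x * g x) \<in> product_sums" using assms by (rule product_sums.prod)
next
  fix h :: "real^'d \<Rightarrow> real" and i assume "h \<in> product_sums"
  then show "(\<lambda>x. frechet_derivative h (at x) (axis i 1)) \<in> product_sums"
  proof (induction rule: product_sums.induct)
    case (prod f g)
    have "frechet_derivative (\<lambda>x. f x * g x) (at x) =
        (\<lambda>v. f x * frechet_derivative g (at x) v + frechet_derivative f (at x) v * g x)" for x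
      by (intro frechet_derivative_at[symmetric] has_derivative_mult)
         (simp_all add: prod schwartz_function_differentiable flip: frechet_derivative_works)
    then show ?case
      using prod by (auto intro!: product_sums.intros schwartz_function_partial)
  next
    case (sum f g)
    have "frechet_derivative (\<lambda>x. f x + g x) (at x) =
        (\<lambda>v. frechet_derivative f (at x) v + frechet_derivative g (at x) v)" for x
      by (intro frechet_derivative_at[symmetric] has_derivative_add)
         (simp_all add: sum product_sums_differentiable flip: frechet_derivative_works)
    then show ?case
      using sum by (auto intro!: product_sums.intros)
  qed
next
  fix h :: "real^'d \<Rightarrow> real" and k assume "h \<in> product_sums"
  then show "bounded (range (\<lambda>x. (1 + norm x) ^ k * h x))"
  proof (induction rule: product_sums.induct)
    case (prod f g)
    obtain B where B: "\<And>x. \<bar>(1 + norm x) ^ k * f x\<bar> \<le> B"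
      using schwartz_function_decay[OF prod(1), of k] by (auto simp: bounded_iff)
    obtain C where C: "\<And>x. \<bar>g x\<bar> \<le> C"
      using schwartz_function_decay[OF prod(2), of 0] by (auto simp: bounded_iff)
    have "\<bar>(1 + norm x) ^ k * (f x * g x)\<bar> \<le> B * C" for x
    proof -
      have "\<bar>(1 + norm x) ^ k * (f x * g x)\<bar> = \<bar>(1 + norm x) ^ k * f x\<bar> * \<bar>g x\<bar>"
        by (simp add: abs_mult)
      also have "\<dots> \<le> B * C"
        using abs_ge_zero order_trans[OF abs_ge_zero B[of x]] by (rule mult_mono[OF B C, rotated])
      finally show ?thesis .
    qed
    then show ?case by (auto simp: bounded_iff)
  next
    case (sum f g)
    then show ?case by (auto simp: distrib_left intro!: bounded_plus_comp)
  qed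
qed (rule product_sums_differentiable)

lemma schwartz_function_power:
  "schwartz_function f \<Longrightarrow> schwartz_function (\<lambda>x. f x ^ Suc n)"
  by (induction n) (auto intro: schwartz_function_mult)

text \<open>Polynomials times a Gaussian supply all the concrete Schwartz functions of the proof. That this class
is stable under differentiation rests on directional derivatives of polynomials being polynomials.\<close>

lemma real_polynomial_function_has_derivative:
  assumes "real_polynomial_function (p :: 'a::real_normed_vector \<Rightarrow> real)"
  shows "\<exists>q. \<forall>v. real_polynomial_function (q v) \<and> (\<forall>x. (p has_derivative (\<lambda>v. q v x)) (at x))"
  using assms
proof (induction rule: real_polynomial_function.induct)
  case (linear f)
  then show ?case
    by (intro exI[of _ "\<lambda>v x. f v"]) (auto intro: bounded_linear_imp_has_derivative)
next
  case (const c)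
  show ?case by (intro exI[of _ "\<lambda>v x. 0"]) auto
next
  case (add f g)
  then obtain q r where
    "\<forall>v. real_polynomial_function (q v) \<and> (\<forall>x. (f has_derivative (\<lambda>v. q v x)) (at x))"
    "\<forall>v. real_polynomial_function (r v) \<and> (\<forall>x. (g has_derivative (\<lambda>v. r v x)) (at x))" by blast
  then show ?case
    by (intro exI[of _ "\<lambda>v x. q v x + r v x"]) (auto intro: has_derivative_add)
next
  case (mult f g)
  then obtain q r where
    "\<forall>v. real_polynomial_function (q v) \<and> (\<forall>x. (f has_derivative (\<lambda>v. q v x)) (at x))"
    "\<forall>v. real_polynomial_function (r v) \<and> (\<forall>x. (g has_derivative (\<lambda>v. r v x)) (at x))" by blast
  then show ?case using mult.hyps
    by (intro exI[of _ "\<lambda>v x. f x * r v x + q v x * g x"]) (auto intro!: has_derivative_mult real_polynomial_function.intros(3,4))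
qed

lemma real_polynomial_function_growth:
  assumes "real_polynomial_function (p :: 'a::real_normed_vector \<Rightarrow> real)"
  shows "\<exists>C n. \<forall>x. \<bar>p x\<bar> \<le> C * (1 + norm x) ^ n"
  using assms
proof (induction rule: real_polynomial_function.induct)
  case (linear f)
  then obtain K where "0 \<le> K" "\<And>x. norm (f x) \<le> norm x * K" 
    using bounded_linear.nonneg_bounded by blast
  then have "\<bar>f x\<bar> \<le> K * (1 + norm x) ^ 1" for x
    by (smt (verit) mult.commute mult_left_mono power_one_right real_norm_def)
  then show ?case by blast
next
  case (const c)
  show ?case by (rule exI[of _ "\<bar>c\<bar>"], rule exI[of _ 0]) auto
next
  case (add f g)
  then obtain C m D n where
    1: "\<And>x. \<bar>f x\<bar> \<le> C * (1 + norm x) ^ m" "\<And>x. \<bar>g x\<bar> \<le> D * (1 + norm x) ^ n" by metis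
  have "\<bar>f x + g x\<bar> \<le> (\<bar>C\<bar> + \<bar>D\<bar>) * (1 + norm x) ^ (m + n)" for x
  proof -
    have "C * (1 + norm x) ^ m \<le> \<bar>C\<bar> * (1 + norm x) ^ (m + n)"
      "D * (1 + norm x) ^ n \<le> \<bar>D\<bar> * (1 + norm x) ^ (m + n)"
      by (intro mult_mono power_increasing; simp)+
    with 1[of x] show ?thesis unfolding distrib_right by linarith
  qed
  then show ?case by blast
next
  case (mult f g)
  then obtain C m D n where
    1: "\<And>x. \<bar>f x\<bar> \<le> C * (1 + norm x) ^ m" "\<And>x. \<bar>g x\<bar> \<le> D * (1 + norm x) ^ n" by metis
  have "\<bar>f x * g x\<bar> \<le> (C * D) * (1 + norm x) ^ (m + n)" for x
  proof -
    have "\<bar>f x * g x\<bar> \<le> (C * (1 + norm x) ^ m) * (D * (1 + norm x) ^ n)"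
      unfolding abs_mult using 1[of x] by (intro mult_mono) auto
    then show ?thesis by (simp add: power_add algebra_simps)
  qed
  then show ?case by blast
qed

lemma real_polynomial_function_inner_self:
  "real_polynomial_function (\<lambda>x::'a::euclidean_space. x \<bullet> x)"
proof -
  have "real_polynomial_function (\<lambda>x::'a. \<Sum>b\<in>Basis. (x \<bullet> b) * (x \<bullet> b))"
    by (intro real_polynomial_function_sum real_polynomial_function.intros(4)
          real_polynomial_function.intros(1) bounded_linear_inner_left) simp
  moreover have "(\<lambda>x::'a. x \<bullet> x) = (\<lambda>x. \<Sum>b\<in>Basis. (x \<bullet> b) * (x \<bullet> b))"
    by (rule ext) (rule euclidean_inner)
  ultimately show ?thesis by simp
qed

definition gaussian :: "real^'d::finite \<Rightarrow> real" where
  "gaussian x = exp (- (x \<bullet> x))"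

lemma gaussian_pos: "0 < gaussian x"
  by (simp add: gaussian_def)

lemma power_times_gaussian_le: "(1 + norm x) ^ n * gaussian x \<le> fact n * exp 2"
proof -
  have "(1 + norm x) ^ n / fact n \<le> exp (1 + norm x)"
  proof -
    have "(1 + norm x) ^ n / fact n = (\<Sum>k\<in>{n}. (1 + norm x) ^ k /\<^sub>R fact k)"
      by (simp add: divide_inverse mult.commute)
    also have "\<dots> \<le> exp (1 + norm x)"
      unfolding exp_def by (intro sum_le_suminf summable_exp_generic) auto
    finally show ?thesis .
  qed
  then have "(1 + norm x) ^ n \<le> fact n * exp (1 + norm x)"
    by (simp add: divide_le_eq mult.commute)
  then have "(1 + norm x) ^ n * gaussian x \<le> fact n * exp (1 + norm x) * gaussian x"
    using gaussian_pos[of x] by (intro mult_right_mono) auto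
  also have "\<dots> = fact n * exp (1 + norm x - (norm x)\<^sup>2)"
    by (simp add: gaussian_def power2_norm_eq_inner mult_exp_exp mult.assoc)
  also have "\<dots> \<le> fact n * exp 2"
  proof -
    \<comment> \<open>the exponent has its maximum, five quarters, at one half\<close>
    have "0 \<le> (norm x - 1/2)\<^sup>2" by simp
    then have "1 + norm x - (norm x)\<^sup>2 \<le> 2" by (simp add: power2_eq_square algebra_simps)
    then show ?thesis by simp
  qed
  finally show ?thesis .
qed

lemma schwartz_function_polynomial_gaussian:
  fixes p :: "real^'d::finite \<Rightarrow> real"
  assumes "real_polynomial_function p"
  shows "schwartz_function (\<lambda>x. p x * gaussian x)"
proof (rule schwartz_function_coinduct[where A = "{\<lambda>x. p x * gaussian x | p. real_polynomial_function p}"])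
  have deriv: "\<exists>q. \<forall>v. real_polynomial_function (q v) \<and>
      (\<forall>x. ((\<lambda>x. p x * gaussian x) has_derivative (\<lambda>v. q v x * gaussian x)) (at x))"
    if p: "real_polynomial_function p" for p :: "real^'d \<Rightarrow> real"
  proof -
    obtain q where q: "\<And>v. real_polynomial_function (q v)"
      "\<And>x. (p has_derivative (\<lambda>v. q v x)) (at x)"
      using real_polynomial_function_has_derivative[OF p] by blast
    have "((\<lambda>x. p x * gaussian x) has_derivative
        (\<lambda>v. (q v x - 2 * (x \<bullet> v) * p x) * gaussian x)) (at x)" for x
      unfolding gaussian_def
      by (rule derivative_eq_intros q(2) refl | simp)+
         (simp add: algebra_simps inner_commute)
    moreover have "real_polynomial_function (\<lambda>x. q v x - 2 * (x \<bullet> v) * p x)" for v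
      by (intro real_polynomial_function_diff real_polynomial_function.intros(4) p q
            real_polynomial_function.intros(2) real_polynomial_function.intros(1) bounded_linear_inner_left)
    ultimately show ?thesis
      by (intro exI[of _ "\<lambda>v x. q v x - 2 * (x \<bullet> v) * p x"]) simp
  qed
  fix f :: "real^'d \<Rightarrow> real" assume "f \<in> {\<lambda>x. p x * gaussian x | p. real_polynomial_function p}"
  then obtain p where f: "f = (\<lambda>x. p x * gaussian x)" and p: "real_polynomial_function p" by blast
  from deriv[OF p] obtain q where q: "\<And>v. real_polynomial_function (q v)"
      "\<And>x. (f has_derivative (\<lambda>v. q v x * gaussian x)) (at x)" unfolding f by blast
  from q(2) show "f differentiable (at x)" for x by (auto simp: differentiable_def)
  have "frechet_derivative f (at x) = (\<lambda>v. q v x * gaussian x)" for x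
    using q(2) by (metis frechet_derivative_at)
  then show "(\<lambda>x. frechet_derivative f (at x) (axis i 1)) \<in> {\<lambda>x. p x * gaussian x | p. real_polynomial_function p}" for i
    using q(1) by auto
  obtain C n where C: "\<And>x. \<bar>p x\<bar> \<le> C * (1 + norm x) ^ n"
    using real_polynomial_function_growth[OF p] by blast
  have C0: "0 \<le> C" using C[of 0] by simp
  have "\<bar>(1 + norm x) ^ k * f x\<bar> \<le> C * (fact (k + n) * exp 2)" for k x
  proof -
    have "\<bar>(1 + norm x) ^ k * f x\<bar> = (1 + norm x) ^ k * \<bar>p x\<bar> * gaussian x"
      using gaussian_pos[of x] by (simp add: f abs_mult)
    also have "\<dots> \<le> (1 + norm x) ^ k * (C * (1 + norm x) ^ n) * gaussian x"
      using C[of x] gaussian_pos[of x] by (intro mult_right_mono mult_left_mono) auto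
    also have "\<dots> = C * ((1 + norm x) ^ (k + n) * gaussian x)"
      by (simp add: power_add algebra_simps)
    also have "\<dots> \<le> C * (fact (k + n) * exp 2)"
      by (intro mult_left_mono power_times_gaussian_le C0)
    finally show ?thesis .
  qed
  then show "bounded (range (\<lambda>x. (1 + norm x) ^ k * f x))" for k
    by (auto simp: bounded_iff)
qed (use assms in blast)

lemma schwartz_function_gaussian: "schwartz_function gaussian"
  using schwartz_function_polynomial_gaussian[OF real_polynomial_function.intros(2)[of 1]] by simp

lemma schwartz_function_bounded:
  assumes "schwartz_function f"
  obtains B where "0 < B" "\<And>x. \<bar>f x\<bar> \<le> B"
proof -
  obtain B where B: "\<And>x. \<bar>f x\<bar> \<le> B"
    using schwartz_function_decay[OF assms, of 0] by (auto simp: bounded_iff)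
  then have "0 < \<bar>B\<bar> + 1" "\<And>x. \<bar>f x\<bar> \<le> \<bar>B\<bar> + 1" by (auto intro: order_trans[OF B])
  then show thesis by (rule that)
qed

lemma schwartz_fun_exists: "schwartz_function f \<Longrightarrow> \<exists>\<phi>. schwartz_fun \<phi> = f"
  by (metis Abs_schwartz_inverse mem_Collect_eq)

lemma schwartz_fun_continuous: "continuous_on UNIV (schwartz_fun \<phi>)"
  using schwartz_fun[of \<phi>]
  by (auto simp: continuous_on_eq_continuous_at
      intro!: differentiable_imp_continuous_within schwartz_function_differentiable)

lift_definition schwartz_mult :: "'d::finite schwartz \<Rightarrow> 'd schwartz \<Rightarrow> 'd schwartz"
  is "\<lambda>f g x. f x * g x" by (rule schwartz_function_mult)


section \<open>Functions of slow growth as distributions\<close>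

text \<open>The essential supremum is replaced once and for all by an almost everywhere bound, which is easy to
add, scale, translate and integrate.\<close>

lemma L_inf_nat_iff:
  "f \<in> L_inf (real n) \<longleftrightarrow> f \<in> borel_measurable lebesgue \<and>
     (\<exists>C. AE x in lebesgue. \<bar>f x\<bar> \<le> C * (1 + norm x) ^ n)" (is "?l \<longleftrightarrow> ?m \<and> ?r")
proof -
  have eq: "ereal (\<bar>f x\<bar> * (1 + norm x) powr (- real n)) \<le> ereal C \<longleftrightarrow> \<bar>f x\<bar> \<le> C * (1 + norm x) ^ n" for x C
  proof -
    have "0 < 1 + norm x" by (simp add: add_pos_nonneg)
    then show ?thesis by (simp add: powr_minus powr_realpow field_simps)
  qed
  let ?g = "\<lambda>x. ereal (\<bar>f x\<bar> * (1 + norm x) powr (- real n))"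
  show ?thesis
  proof
    assume l: ?l
    then have "esssup lebesgue ?g < \<infinity>" by (simp add: L_inf_def)
    then obtain C where C: "esssup lebesgue ?g \<le> ereal C"
      by (cases "esssup lebesgue ?g") auto
    have "AE x in lebesgue. ?g x \<le> ereal C"
      using esssup_AE[of ?g lebesgue] by eventually_elim (rule order_trans[OF _ C])
    then show "?m \<and> ?r" using l unfolding eq by (auto simp: L_inf_def)
  next
    assume r: "?m \<and> ?r"
    then obtain C where m: ?m and "AE x in lebesgue. \<bar>f x\<bar> \<le> C * (1 + norm x) ^ n" by blast
    then have "AE x in lebesgue. ?g x \<le> ereal C" unfolding eq by simp
    moreover have "(\<lambda>x::real^'a. 1 + norm x) \<in> borel_measurable lebesgue"
      by (rule measurable_completion) simp
    then have "?g \<in> borel_measurable lebesgue" using m by measurable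
    ultimately have "esssup lebesgue ?g \<le> ereal C" by (intro esssup_I)
    then show ?l using m by (auto simp: L_inf_def)
  qed
qed

lemma L_inf_zero: "(\<lambda>x. 0) \<in> L_inf (real n)"
  by (auto simp: L_inf_nat_iff intro!: exI[of _ 0])

lemma L_inf_add:
  assumes "f \<in> L_inf (real n)" "g \<in> L_inf (real n)"
  shows "(\<lambda>x. f x + g x) \<in> L_inf (real n)"
proof -
  obtain C D where "AE x in lebesgue. \<bar>f x\<bar> \<le> C * (1 + norm x) ^ n"
    "AE x in lebesgue. \<bar>g x\<bar> \<le> D * (1 + norm x) ^ n"
    using assms by (auto simp: L_inf_nat_iff)
  then have "AE x in lebesgue. \<bar>f x + g x\<bar> \<le> (C + D) * (1 + norm x) ^ n"
    by eventually_elim (auto simp: distrib_right)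
  then show ?thesis using assms by (auto simp: L_inf_nat_iff)
qed

lemma L_inf_scale:
  assumes "f \<in> L_inf (real n)"
  shows "(\<lambda>x. c * f x) \<in> L_inf (real n)"
proof -
  obtain C where "AE x in lebesgue. \<bar>f x\<bar> \<le> C * (1 + norm x) ^ n"
    using assms by (auto simp: L_inf_nat_iff)
  then have "AE x in lebesgue. \<bar>c * f x\<bar> \<le> (\<bar>c\<bar> * C) * (1 + norm x) ^ n"
    by eventually_elim (auto simp: abs_mult mult.assoc intro: mult_left_mono)
  then show ?thesis using assms by (auto simp: L_inf_nat_iff)
qed

lemma L_inf_sum:
  assumes "finite I" "\<And>i. i \<in> I \<Longrightarrow> f i \<in> L_inf (real n)"
  shows "(\<lambda>x. \<Sum>i\<in>I. f i x) \<in> L_inf (real n)"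
  using assms by (induction I rule: finite_induct) (auto intro: L_inf_zero L_inf_add)

lemma translation_measurable_lebesgue [measurable]:
    "(\<lambda>x. x + a) \<in> lebesgue \<rightarrow>\<^sub>M (lebesgue :: 'a::euclidean_space measure)"
  and lebesgue_distr_translation:
    "distr lebesgue lebesgue (\<lambda>x. x + a) = (lebesgue :: 'a::euclidean_space measure)"
proof -
  have T: "(\<lambda>x. a + (\<Sum>j\<in>Basis. (1 * (x \<bullet> j)) *\<^sub>R j)) = (\<lambda>x. x + a)"
    by (auto simp: euclidean_representation add.commute)
  show "(\<lambda>x. x + a) \<in> lebesgue \<rightarrow>\<^sub>M lebesgue"
    using lebesgue_affine_measurable[of "\<lambda>_. 1" a] unfolding T by simp
  show "distr lebesgue lebesgue (\<lambda>x. x + a) = lebesgue"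
    using lebesgue_affine_euclidean[of "\<lambda>_. 1" a] unfolding T by (simp add: density_1)
qed

lemma L_inf_shift:
  assumes "f \<in> L_inf (real n)"
  shows "(\<lambda>x. f (x - a)) \<in> L_inf (real n)"
proof -
  obtain C where C: "AE x in lebesgue. \<bar>f x\<bar> \<le> C * (1 + norm x) ^ n"
    using assms by (auto simp: L_inf_nat_iff)
  have [measurable]: "f \<in> borel_measurable lebesgue" using assms by (simp add: L_inf_nat_iff)
  have m [measurable]: "(\<lambda>x. f (x + - a)) \<in> borel_measurable lebesgue"
    by (rule measurable_compose[OF translation_measurable_lebesgue]) simp
  have [measurable]: "(\<lambda>x::real^'a. 1 + norm x) \<in> borel_measurable lebesgue"
    by (rule measurable_completion) simp
  have "AE x in distr lebesgue lebesgue (\<lambda>x. x + - a). \<bar>f x\<bar> \<le> C * (1 + norm x) ^ n"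
    unfolding lebesgue_distr_translation by (rule C)
  then have "AE x in lebesgue. \<bar>f (x + - a)\<bar> \<le> C * (1 + norm (x + - a)) ^ n"
    by (subst (asm) AE_distr_iff) measurable
  then have "AE x in lebesgue. \<bar>f (x + - a)\<bar> \<le> (\<bar>C\<bar> * (1 + norm a) ^ n) * (1 + norm x) ^ n"
  proof eventually_elim
    case (elim x)
    have "(1 + norm (x + - a)) ^ n \<le> (1 + norm a) ^ n * (1 + norm x) ^ n"
      using one_plus_norm_shift[of "x + - a" n a] by simp
    then have "C * (1 + norm (x + - a)) ^ n \<le> \<bar>C\<bar> * ((1 + norm a) ^ n * (1 + norm x) ^ n)"
      by (intro mult_mono) auto
    with elim show ?case by (simp add: mult.assoc)
  qed
  then show ?thesis using m by (auto simp: L_inf_nat_iff)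
qed

text \<open>The function is dominated by the product of the one-dimensional functions
\<open>1 / (1 + t\<^sup>2)\<close>, whose integral factorises. This is where the exponent, twice the dimension,
comes from.\<close>

lemma integrable_inverse_power_norm:
  "integrable lebesgue (\<lambda>x::real^'d::finite. inverse ((1 + norm x) ^ (2 * CARD('d))))"
proof -
  let ?h = "\<lambda>x::real^'d. \<Prod>b\<in>Basis. inverse (1 + (x \<bullet> b)\<^sup>2)"
  have "integrable lborel (\<lambda>t::real. inverse (1 + t\<^sup>2))"
    using integrable_inverse_1_plus_square by (simp add: set_integrable_def einterval_eq_UNIV)
  then have fin: "(\<integral>\<^sup>+t. ennreal (inverse (1 + t\<^sup>2)) \<partial>(lborel :: real measure)) < \<infinity>"
    by (simp add: integrable_iff_bounded)
  have "integrable lborel ?h"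
  proof (rule integrableI_nonneg)
    have "(\<integral>\<^sup>+x. ennreal (?h x) \<partial>lborel) = (\<integral>\<^sup>+x. (\<Prod>b\<in>(Basis::(real^'d) set). ennreal (inverse (1 + (x \<bullet> b)\<^sup>2))) \<partial>lborel)"
      by (subst prod_ennreal) auto
    also have "\<dots> = (\<Prod>b\<in>(Basis::(real^'d) set). \<integral>\<^sup>+t. ennreal (inverse (1 + t\<^sup>2)) \<partial>lborel)"
      by (rule nn_integral_lborel_prod) auto
    also have "\<dots> < \<infinity>" using fin by (simp add: power_less_top_ennreal)
    finally show "(\<integral>\<^sup>+x. ennreal (?h x) \<partial>lborel) < \<infinity>" .
  qed (auto intro!: prod_nonneg)
  then have h: "integrable lebesgue ?h" by (subst integrable_completion) auto
  have le: "inverse ((1 + norm x) ^ (2 * CARD('d))) \<le> ?h x" for x :: "real^'d"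
  proof -
    have "(\<Prod>b\<in>Basis. 1 + (x \<bullet> b)\<^sup>2) \<le> (\<Prod>b\<in>(Basis::(real^'d) set). (1 + norm x)\<^sup>2)"
    proof (intro prod_mono conjI)
      fix b :: "real^'d" assume "b \<in> Basis"
      then have "\<bar>x \<bullet> b\<bar> \<le> norm x" by (rule Basis_le_norm)
      then have "(x \<bullet> b)\<^sup>2 \<le> (norm x)\<^sup>2" by (simp add: abs_le_square_iff[symmetric])
      then show "1 + (x \<bullet> b)\<^sup>2 \<le> (1 + norm x)\<^sup>2"
        by (smt (verit) norm_ge_zero power2_sum one_power2 mult_nonneg_nonneg)
    qed auto
    also have "\<dots> = (1 + norm x) ^ (2 * CARD('d))" by (simp add: power_mult)
    finally have "inverse ((1 + norm x) ^ (2 * CARD('d))) \<le> inverse (\<Prod>b\<in>Basis. 1 + (x \<bullet> b)\<^sup>2)"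
      by (intro le_imp_inverse_le prod_pos) (auto simp: add_pos_nonneg)
    also have "\<dots> = ?h x"
      using prod_inversef[of "\<lambda>b. 1 + (x \<bullet> b)\<^sup>2" Basis] by (simp add: comp_def)
    finally show ?thesis .
  qed
  show ?thesis
  proof (rule Bochner_Integration.integrable_bound[OF h])
    show "(\<lambda>x::real^'d. inverse ((1 + norm x) ^ (2 * CARD('d)))) \<in> borel_measurable lebesgue"
      by (rule measurable_completion) simp
    show "AE x::real^'d in lebesgue. norm (inverse ((1 + norm x) ^ (2 * CARD('d)))) \<le> norm (?h x)"
      using le by (auto intro!: AE_I2 order_trans[OF _ le] simp: prod_nonneg abs_prod)
  qed
qed

lemma schwartz_fun_measurable [measurable]: "schwartz_fun \<phi> \<in> borel_measurable lebesgue"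
proof -
  have "schwartz_fun \<phi> \<in> borel_measurable borel"
    using schwartz_fun_continuous by (rule borel_measurable_continuous_onI)
  then show ?thesis by (intro measurable_completion) simp
qed

lemma schwartz_fun_le_norm: "(1 + norm x) ^ N * \<bar>schwartz_fun \<phi> x\<bar> \<le> schwartz_norm N \<phi>"
proof -
  have "(1 + norm x) ^ N * \<bar>schwartz_fun \<phi> x\<bar>
      \<le> (SUP x. (1 + norm x) ^ N * \<bar>iter_partial [] (schwartz_fun \<phi>) x\<bar>)"
    using cSUP_upper[OF _ schwartz_norm_bdd[of N "[]" \<phi>], of x] by simp
  also have "\<dots> \<le> schwartz_norm N \<phi>"
    unfolding schwartz_norm_def
    by (rule member_le_sum) (auto intro: finite_multi_indices schwartz_norm_term_nonneg
        simp del: iter_partial.simps)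
  finally show ?thesis .
qed

text \<open>The weight that makes a function of slow growth integrable is paid for by a Schwartz seminorm of the
test function. This is why \<open>fun_distr\<close> has its intended meaning on all the spaces
\<open>L_inf (real n)\<close>.\<close>

lemma L_inf_times_schwartz:
  fixes f :: "real^'d::finite \<Rightarrow> real"
  assumes "f \<in> L_inf (real n)"
  shows "integrable lebesgue (\<lambda>x. f x * schwartz_fun \<phi> x)"
    and "\<exists>C. \<forall>\<phi>. \<bar>LINT x|lebesgue. f x * schwartz_fun \<phi> x\<bar> \<le> C * schwartz_norm (n + 2 * CARD('d)) \<phi>"
proof -
  obtain C where C: "AE x in lebesgue. \<bar>f x\<bar> \<le> C * (1 + norm x) ^ n"
    and [measurable]: "f \<in> borel_measurable lebesgue"
    using assms by (auto simp: L_inf_nat_iff)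
  let ?W = "\<lambda>x::real^'d. inverse ((1 + norm x) ^ (2 * CARD('d)))"
  let ?N = "n + 2 * CARD('d)"
  have bound: "AE x in lebesgue. \<bar>f x * schwartz_fun \<phi> x\<bar> \<le> \<bar>C\<bar> * schwartz_norm ?N \<phi> * ?W x" for \<phi>
    using C
  proof eventually_elim
    case (elim x)
    have pos: "0 < (1 + norm x) ^ (2 * CARD('d))" by (simp add: add_pos_nonneg)
    have "C * (1 + norm x) ^ n \<le> \<bar>C\<bar> * (1 + norm x) ^ n" by (intro mult_right_mono) auto
    with elim have "\<bar>f x\<bar> \<le> \<bar>C\<bar> * (1 + norm x) ^ n" by linarith
    then have "\<bar>f x * schwartz_fun \<phi> x\<bar> \<le> (\<bar>C\<bar> * (1 + norm x) ^ n) * \<bar>schwartz_fun \<phi> x\<bar>"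
      unfolding abs_mult by (rule mult_right_mono) simp
    also have "\<dots> = \<bar>C\<bar> * ((1 + norm x) ^ ?N * \<bar>schwartz_fun \<phi> x\<bar>) * ?W x"
    proof -
      have "(1 + norm x) ^ (2 * CARD('d)) * ?W x = 1" using pos by (intro right_inverse) linarith
      then show ?thesis by (simp only: power_add mult_ac mult_1_right)
    qed
    also have "\<dots> \<le> \<bar>C\<bar> * schwartz_norm ?N \<phi> * ?W x"
      using pos by (intro mult_right_mono mult_left_mono schwartz_fun_le_norm) auto
    finally show ?case .
  qed
  have W: "integrable lebesgue (\<lambda>x. \<bar>C\<bar> * schwartz_norm ?N \<phi> * ?W x)" for \<phi> :: "'d schwartz"
    using integrable_inverse_power_norm[where 'd = 'd] by simp
  have int: "integrable lebesgue (\<lambda>x. f x * schwartz_fun \<phi> x)" for \<phi>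
    by (rule Bochner_Integration.integrable_bound[OF W[of \<phi>]])
       (use bound[of \<phi>] in \<open>measurable, eventually_elim, auto intro: order_trans\<close>)
  then show "integrable lebesgue (\<lambda>x. f x * schwartz_fun \<phi> x)" .
  have "\<bar>LINT x|lebesgue. f x * schwartz_fun \<phi> x\<bar>
      \<le> (\<bar>C\<bar> * (LINT x|lebesgue. ?W x)) * schwartz_norm ?N \<phi>" for \<phi>
  proof -
    have "\<bar>LINT x|lebesgue. f x * schwartz_fun \<phi> x\<bar> \<le> (LINT x|lebesgue. \<bar>f x * schwartz_fun \<phi> x\<bar>)"
      by (rule integral_abs_bound)
    also have "\<dots> \<le> (LINT x|lebesgue. \<bar>C\<bar> * schwartz_norm ?N \<phi> * ?W x)"
      by (intro integral_mono_AE W bound integrable_abs int)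
    finally show ?thesis by (simp add: algebra_simps)
  qed
  then show "\<exists>C. \<forall>\<phi>. \<bar>LINT x|lebesgue. f x * schwartz_fun \<phi> x\<bar> \<le> C * schwartz_norm ?N \<phi>"
    by blast
qed

lemma apply_fun_distr:
  assumes "f \<in> L_inf (real n)"
  shows "apply_distr (fun_distr f) \<phi> = (LINT x|lebesgue. f x * schwartz_fun \<phi> x)"
proof -
  note int = L_inf_times_schwartz(1)[OF assms]
  have "tempered_functional (\<lambda>\<phi>. LINT x|lebesgue. f x * schwartz_fun \<phi> x)"
    unfolding tempered_functional_def
  proof
    show "linear (\<lambda>\<phi>. LINT x|lebesgue. f x * schwartz_fun \<phi> x)"
      using int by (auto simp: linear_iff plus_schwartz.rep_eq scaleR_schwartz.rep_eq
          distrib_left mult.left_commute)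
  qed (use L_inf_times_schwartz(2)[OF assms] in blast)
  then show ?thesis by (simp add: fun_distr_def Abs_tempered_inverse)
qed

lemma tempered_eqI: "(\<And>\<phi>. apply_distr u \<phi> = apply_distr v \<phi>) \<Longrightarrow> u = v"
  by (metis apply_distr_inject ext)

lemma fun_distr_add:
  assumes "f \<in> L_inf (real n)" "g \<in> L_inf (real n)"
  shows "fun_distr (\<lambda>x. f x + g x) = fun_distr f + fun_distr g"
  by (rule tempered_eqI)
     (simp add: apply_fun_distr[OF L_inf_add[OF assms]] plus_tempered.rep_eq
        apply_fun_distr[OF assms(1)] apply_fun_distr[OF assms(2)] distrib_right
        L_inf_times_schwartz(1)[OF assms(1)] L_inf_times_schwartz(1)[OF assms(2)])

lemma fun_distr_scale:
  assumes "f \<in> L_inf (real n)"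
  shows "fun_distr (\<lambda>x. c * f x) = c *\<^sub>R fun_distr f"
  by (rule tempered_eqI)
     (simp add: apply_fun_distr[OF L_inf_scale[OF assms]] scaleR_tempered.rep_eq
        apply_fun_distr[OF assms] mult.assoc)

lemma fun_distr_sum:
  assumes "finite I" "\<And>i. i \<in> I \<Longrightarrow> f i \<in> L_inf (real n)"
  shows "fun_distr (\<lambda>x. \<Sum>i\<in>I. f i x) = (\<Sum>i\<in>I. fun_distr (f i))"
  using assms
proof (induction I rule: finite_induct)
  case empty
  show ?case by (rule tempered_eqI) (simp add: apply_fun_distr[OF L_inf_zero] zero_tempered.rep_eq)
next
  case (insert i I)
  then show ?case by (simp add: fun_distr_add[of _ n] L_inf_sum)
qed

lemma fun_distr_shift:
  assumes "f \<in> L_inf (real n)"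
  shows "fun_distr (\<lambda>x. f (x - a)) = shift a (fun_distr f)"
proof (rule tempered_eqI)
  fix \<phi>
  have [measurable]: "(\<lambda>x. f (x - a)) \<in> borel_measurable lebesgue"
    using L_inf_shift[OF assms, of a] by (simp add: L_inf_nat_iff)
  have "(LINT x|lebesgue. f (x - a) * schwartz_fun \<phi> x) =
      (LINT x|distr lebesgue lebesgue (\<lambda>x. x + a). f (x - a) * schwartz_fun \<phi> x)"
    by (simp add: lebesgue_distr_translation)
  also have "\<dots> = (LINT x|lebesgue. f x * schwartz_fun \<phi> (x + a))"
    by (subst integral_distr) auto
  finally show "apply_distr (fun_distr (\<lambda>x. f (x - a))) \<phi> = apply_distr (shift a (fun_distr f)) \<phi>"
    by (simp add: apply_fun_distr[OF L_inf_shift[OF assms]] shift.rep_eq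
        apply_fun_distr[OF assms] schwartz_shift.rep_eq)
qed


section \<open>Splitting a measure without loss of norm\<close>

lemma abs_le_sup_norm: "\<bar>schwartz_fun \<phi> x\<bar> \<le> sup_norm (schwartz_fun \<phi>)"
  unfolding sup_norm_def
proof (rule cSUP_upper)
  obtain B where "\<And>x. \<bar>schwartz_fun \<phi> x\<bar> \<le> B"
    using schwartz_fun[of \<phi>] schwartz_function_bounded by blast
  then show "bdd_above (range (\<lambda>x. \<bar>schwartz_fun \<phi> x\<bar>))" by (auto intro!: bdd_aboveI[of _ B])
qed simp

lemma sup_norm_le: "(\<And>x. \<bar>f x\<bar> \<le> C) \<Longrightarrow> sup_norm f \<le> C"
  unfolding sup_norm_def by (rule cSUP_least) auto

lemma sup_norm_nonneg: "0 \<le> sup_norm (schwartz_fun \<phi>)"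
  using abs_le_sup_norm[of \<phi> 0] by simp

lemma sup_norm_scale: "sup_norm (schwartz_fun (c *\<^sub>R \<phi>)) = \<bar>c\<bar> * sup_norm (schwartz_fun \<phi>)"
proof (rule antisym)
  show "sup_norm (schwartz_fun (c *\<^sub>R \<phi>)) \<le> \<bar>c\<bar> * sup_norm (schwartz_fun \<phi>)"
    by (rule sup_norm_le) (simp add: scaleR_schwartz.rep_eq abs_mult abs_le_sup_norm mult_left_mono)
  show "\<bar>c\<bar> * sup_norm (schwartz_fun \<phi>) \<le> sup_norm (schwartz_fun (c *\<^sub>R \<phi>))"
  proof (cases "c = 0")
    case False
    have "sup_norm (schwartz_fun \<phi>) \<le> sup_norm (schwartz_fun (c *\<^sub>R \<phi>)) / \<bar>c\<bar>"
      using False abs_le_sup_norm[of "c *\<^sub>R \<phi>"]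
      by (intro sup_norm_le) (simp add: scaleR_schwartz.rep_eq abs_mult field_simps)
    then show ?thesis using False by (simp add: field_simps)
  qed (simp add: sup_norm_nonneg)
qed

lemma sup_norm_uminus: "sup_norm (schwartz_fun (- \<phi>)) = sup_norm (schwartz_fun \<phi>)"
  by (simp add: sup_norm_def uminus_schwartz.rep_eq)

lemma linear_apply_distr: "linear (apply_distr w)"
  using apply_distr[of w] by (simp add: tempered_functional_def)

lemmas apply_distr_add = linear_add[OF linear_apply_distr]
lemmas apply_distr_uminus = linear_neg[OF linear_apply_distr]
lemmas apply_distr_diff = linear_diff[OF linear_apply_distr]
lemmas apply_distr_scale = linear_scale[OF linear_apply_distr]
lemmas apply_distr_sum = linear_sum[OF linear_apply_distr]

lemma sum_tempered_apply: "apply_distr (\<Sum>i\<in>I. u i) \<phi> = (\<Sum>i\<in>I. apply_distr (u i) \<phi>)"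
  by (induction I rule: infinite_finite_induct) (simp_all add: zero_tempered.rep_eq plus_tempered.rep_eq)

lemma sum_schwartz_fun: "schwartz_fun (\<Sum>i\<in>I. \<phi> i) x = (\<Sum>i\<in>I. schwartz_fun (\<phi> i) x)"
  by (induction I rule: infinite_finite_induct) (simp_all add: zero_schwartz.rep_eq plus_schwartz.rep_eq)

lemma schwartz_fun_eqI: "(\<And>x. schwartz_fun \<phi> x = schwartz_fun \<psi> x) \<Longrightarrow> \<phi> = \<psi>"
  by (metis schwartz_fun_inject ext)

lemma M_norm_le:
  "(\<And>\<phi>. sup_norm (schwartz_fun \<phi>) = 1 \<Longrightarrow> apply_distr w \<phi> \<le> C) \<Longrightarrow> M_norm w \<le> ereal C"
  unfolding M_norm_def by (rule SUP_least) auto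

lemma apply_le_M_norm:
  assumes "M_norm w \<le> ereal C"
  shows "apply_distr w \<phi> \<le> C * sup_norm (schwartz_fun \<phi>)"
proof (cases "sup_norm (schwartz_fun \<phi>) = 0")
  case True
  then have "schwartz_fun \<phi> x = 0" for x using abs_le_sup_norm[of \<phi> x] by simp
  then have "\<phi> = 0" by (intro schwartz_fun_eqI) (simp add: zero_schwartz.rep_eq)
  then show ?thesis using True by (simp add: linear_0[OF linear_apply_distr])
next
  case False
  let ?s = "sup_norm (schwartz_fun \<phi>)"
  have s: "0 < ?s" using False sup_norm_nonneg[of \<phi>] by simp
  have "ereal (apply_distr w ((1 / ?s) *\<^sub>R \<phi>)) \<le> M_norm w"
    unfolding M_norm_def using s by (intro SUP_upper) (simp add: sup_norm_scale)
  also note assms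
  finally show ?thesis using s by (simp add: apply_distr_scale field_simps)
qed

text \<open>The supremum that defines the norm ranges over a nonempty symmetric set (a scaled Gaussian and its
negative belong to it), hence it is not negative, and in particular not minus infinity.\<close>

lemma M_norm_real:
  assumes "M_norm w < \<infinity>"
  obtains r where "0 \<le> r" "M_norm w = ereal r"
proof -
  obtain g :: "'a schwartz" where g: "schwartz_fun g = gaussian"
    using schwartz_fun_exists[OF schwartz_function_gaussian] by blast
  have "schwartz_fun g 0 = 1" by (simp add: g gaussian_def)
  then have 0: "0 < sup_norm (schwartz_fun g)" using abs_le_sup_norm[of g 0] by simp
  define h where "h = (1 / sup_norm (schwartz_fun g)) *\<^sub>R g"
  have h: "sup_norm (schwartz_fun h) = 1" "sup_norm (schwartz_fun (- h)) = 1"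
    using 0 by (simp_all only: sup_norm_uminus) (simp_all add: h_def sup_norm_scale)
  have "ereal (apply_distr w h) \<le> M_norm w" "ereal (apply_distr w (- h)) \<le> M_norm w"
    unfolding M_norm_def using h by (intro SUP_upper; simp)+
  then have "0 \<le> M_norm w"
    by (cases "M_norm w") (auto simp: apply_distr_uminus)
  then show thesis using assms that by (cases "M_norm w") auto
qed

lemma abs_apply_le_M_norm:
  assumes "M_norm w \<le> ereal C"
  shows "\<bar>apply_distr w \<phi>\<bar> \<le> C * sup_norm (schwartz_fun \<phi>)"
  using apply_le_M_norm[OF assms, of \<phi>] apply_le_M_norm[OF assms, of "- \<phi>"]
  by (simp add: apply_distr_uminus sup_norm_uminus)

text \<open>The pieces into which \<open>w\<close> splits without loss of total variation. Restrictions of a measure to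
Borel sets, or products with densities between 0 and 1, are of this kind. The inequality expresses
additivity of the norm, the converse being the triangle inequality.\<close>

definition fragments :: "'d::finite tempered \<Rightarrow> 'd tempered set" where
  "fragments w = {u. M_norm u + M_norm (w - u) \<le> M_norm w}"

text \<open>On the test functions where \<open>w\<close> nearly attains its norm, a fragment nearly attains its own norm,
with at most the same deficit: the deficits of \<open>u\<close> and of \<open>w - u\<close> are nonnegative and add up
to at most that of \<open>w\<close>.\<close>

lemma fragment_deviation:
  assumes w: "M_norm w = ereal r" and u: "u \<in> fragments w"
  obtains n where
    "\<And>\<phi>. \<bar>apply_distr u \<phi> - n * sup_norm (schwartz_fun \<phi>)\<bar>
       \<le> r * sup_norm (schwartz_fun \<phi>) - apply_distr w \<phi>"
    "M_norm u = ereal n"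
proof -
  have le: "M_norm u + M_norm (w - u) \<le> ereal r" using u w by (simp add: fragments_def)
  then have "M_norm u < \<infinity> \<and> M_norm (w - u) < \<infinity>"
    by (cases "M_norm u"; cases "M_norm (w - u)") auto
  then obtain n n' where n: "M_norm u = ereal n" "M_norm (w - u) = ereal n'"
    by (metis M_norm_real)
  with le have "n' \<le> r - n" by simp
  then have n': "M_norm (w - u) \<le> ereal (r - n)" using n by simp
  have "\<bar>apply_distr u \<phi> - n * sup_norm (schwartz_fun \<phi>)\<bar>
       \<le> r * sup_norm (schwartz_fun \<phi>) - apply_distr w \<phi>" for \<phi>
    using apply_le_M_norm[of u n \<phi>] apply_le_M_norm[OF n', of \<phi>] n
    by (simp add: minus_tempered.rep_eq left_diff_distrib)
  then show thesis using n that by blast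
qed

text \<open>The product of a distribution with a Schwartz function. \<open>Abs_tempered\<close> makes it meaningful only
when the product is tempered, which is immediate for distributions of finite norm.\<close>

definition localize :: "'d::finite schwartz \<Rightarrow> 'd tempered \<Rightarrow> 'd tempered" where
  "localize \<eta> w = Abs_tempered (\<lambda>\<phi>. apply_distr w (schwartz_mult \<eta> \<phi>))"

lemma schwartz_mult_linear: "linear (schwartz_mult \<eta>)"
  by (rule linearI; transfer) (auto simp: algebra_simps)

lemma apply_localize:
  assumes "M_norm w < \<infinity>"
  shows "apply_distr (localize \<eta> w) \<phi> = apply_distr w (schwartz_mult \<eta> \<phi>)"
proof -
  obtain r where r: "0 \<le> r" "M_norm w = ereal r" using M_norm_real[OF assms] by blast
  have "\<bar>apply_distr w (schwartz_mult \<eta> \<phi>)\<bar> \<le> (r * sup_norm (schwartz_fun \<eta>)) * schwartz_norm 0 \<phi>" for \<phi>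
  proof -
    have "\<bar>apply_distr w (schwartz_mult \<eta> \<phi>)\<bar> \<le> r * sup_norm (schwartz_fun (schwartz_mult \<eta> \<phi>))"
      using r by (intro abs_apply_le_M_norm) simp
    also have "\<dots> \<le> r * (sup_norm (schwartz_fun \<eta>) * schwartz_norm 0 \<phi>)"
      using r(1) schwartz_fun_le_norm[of _ 0 \<phi>]
      by (intro mult_left_mono sup_norm_le)
         (auto simp: schwartz_mult.rep_eq abs_mult intro!: mult_mono abs_le_sup_norm sup_norm_nonneg)
    finally show ?thesis by (simp add: mult.assoc)
  qed
  moreover have "linear (\<lambda>\<phi>. apply_distr w (schwartz_mult \<eta> \<phi>))"
    using linear_compose[OF schwartz_mult_linear linear_apply_distr] by (simp add: comp_def)
  ultimately have "tempered_functional (\<lambda>\<phi>. apply_distr w (schwartz_mult \<eta> \<phi>))"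
    unfolding tempered_functional_def by blast
  then show ?thesis by (simp add: localize_def Abs_tempered_inverse)
qed

text \<open>For \<open>\<phi>\<close> and \<open>\<psi>\<close> bounded by 1, the convex combination \<open>\<eta> \<phi> + (1 - \<eta>) \<psi>\<close> is again
bounded by 1, and \<open>w\<close> takes on it the value of the two pieces together. Hence the two suprema add
up to at most the norm of \<open>w\<close>.\<close>

lemma localize_fragment:
  assumes w: "M_norm w < \<infinity>" and \<eta>: "\<And>x. 0 \<le> schwartz_fun \<eta> x" "\<And>x. schwartz_fun \<eta> x \<le> 1"
  shows "localize \<eta> w \<in> fragments w"
proof -
  obtain r where r: "0 \<le> r" "M_norm w = ereal r" using M_norm_real[OF w] by blast
  let ?u = "localize \<eta> w"
  have split: "apply_distr ?u \<phi> + apply_distr (w - ?u) \<psi> \<le> r"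
    if "sup_norm (schwartz_fun \<phi>) = 1" "sup_norm (schwartz_fun \<psi>) = 1" for \<phi> \<psi>
  proof -
    let ?\<theta> = "schwartz_mult \<eta> \<phi> + (\<psi> - schwartz_mult \<eta> \<psi>)"
    have "\<bar>schwartz_fun ?\<theta> x\<bar> \<le> 1" for x
    proof -
      have "schwartz_fun ?\<theta> x = schwartz_fun \<eta> x * schwartz_fun \<phi> x + (1 - schwartz_fun \<eta> x) * schwartz_fun \<psi> x"
        by (simp add: plus_schwartz.rep_eq minus_schwartz.rep_eq schwartz_mult.rep_eq algebra_simps)
      also have "\<bar>\<dots>\<bar> \<le> schwartz_fun \<eta> x * 1 + (1 - schwartz_fun \<eta> x) * 1"
        using \<eta>[of x] abs_le_sup_norm[of \<phi> x] abs_le_sup_norm[of \<psi> x] that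
        by (intro order_trans[OF abs_triangle_ineq] add_mono) (auto simp: abs_mult intro!: mult_left_le)
      finally show ?thesis by simp
    qed
    then have "sup_norm (schwartz_fun ?\<theta>) \<le> 1" by (rule sup_norm_le)
    then have "r * sup_norm (schwartz_fun ?\<theta>) \<le> r" using r by (simp add: mult_left_le)
    moreover have "apply_distr w ?\<theta> \<le> r * sup_norm (schwartz_fun ?\<theta>)"
      using r by (intro apply_le_M_norm) simp
    ultimately show ?thesis
      by (simp add: apply_localize[OF w] minus_tempered.rep_eq apply_distr_add apply_distr_diff)
  qed
  have *: "M_norm ?u \<le> ereal (r - apply_distr (w - ?u) \<psi>)" if "sup_norm (schwartz_fun \<psi>) = 1" for \<psi>
    using split[OF _ that] by (intro M_norm_le) (simp add: le_diff_eq)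
  have "M_norm ?u < \<infinity>"
  proof -
    have "apply_distr ?u \<phi> \<le> r * sup_norm (schwartz_fun \<eta>)" if "sup_norm (schwartz_fun \<phi>) = 1" for \<phi>
    proof -
      have "apply_distr ?u \<phi> \<le> r * sup_norm (schwartz_fun (schwartz_mult \<eta> \<phi>))"
        unfolding apply_localize[OF w] using r by (intro apply_le_M_norm) simp
      also have "\<dots> \<le> r * sup_norm (schwartz_fun \<eta>)"
        using r(1) abs_le_sup_norm[of \<phi>] abs_le_sup_norm[of \<eta>] that
        by (intro mult_left_mono sup_norm_le)
           (auto simp: schwartz_mult.rep_eq abs_mult sup_norm_nonneg
             intro!: order_trans[OF mult_mono[OF abs_le_sup_norm abs_le_sup_norm]])
      finally show ?thesis .
    qed
    then have "M_norm ?u \<le> ereal (r * sup_norm (schwartz_fun \<eta>))" by (rule M_norm_le)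
    then show ?thesis by (rule order.strict_trans1) simp
  qed
  then obtain n where n: "M_norm ?u = ereal n" using M_norm_real by blast
  have "M_norm (w - ?u) \<le> ereal (r - n)"
    by (rule M_norm_le) (use * n in \<open>force simp: le_diff_eq\<close>)
  then have "ereal n + M_norm (w - ?u) \<le> ereal n + ereal (r - n)" by (rule add_left_mono)
  then show ?thesis using n r by (simp add: fragments_def)
qed

section \<open>Measures whose fragments span a finite-dimensional space\<close>

text \<open>Where \<open>\<phi>\<close> is small nothing has to be done. Where it is not, that is on a compact set, \<open>F\<close> is
bounded away from 0 and the powers of \<open>1 - F\<close> tend to 0 geometrically.\<close>

lemma damping_by_vanishing_factor:
  fixes \<phi> F :: "'d::finite schwartz"
  assumes F: "\<And>x. 0 \<le> schwartz_fun F x" "\<And>x. schwartz_fun F x \<le> 1"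
    and zeros: "\<And>x. schwartz_fun F x = 0 \<Longrightarrow> schwartz_fun \<phi> x = 0"
    and "0 < \<epsilon>"
  shows "\<exists>n. \<forall>x. \<bar>(1 - schwartz_fun F x) ^ n * schwartz_fun \<phi> x\<bar> \<le> \<epsilon>"
proof -
  let ?K = "{x. \<epsilon> \<le> \<bar>schwartz_fun \<phi> x\<bar>}"
  have small: "\<bar>(1 - schwartz_fun F x) ^ n * schwartz_fun \<phi> x\<bar> \<le> \<epsilon>" if "x \<notin> ?K" for n x
  proof -
    have "\<bar>(1 - schwartz_fun F x) ^ n\<bar> \<le> 1" using F[of x] by (simp add: power_le_one)
    then show ?thesis using that mult_mono[of "\<bar>(1 - schwartz_fun F x) ^ n\<bar>" 1 "\<bar>schwartz_fun \<phi> x\<bar>" \<epsilon>]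
      by (simp add: abs_mult)
  qed
  show ?thesis
  proof (cases "?K = {}")
    case True
    then show ?thesis using small by blast
  next
    case False
    obtain B where B: "\<And>x. \<bar>(1 + norm x) ^ 1 * schwartz_fun \<phi> x\<bar> \<le> B"
      using schwartz_function_decay[of "schwartz_fun \<phi>" 1] schwartz_fun[of \<phi>] by (auto simp: bounded_iff)
    have "norm x \<le> B / \<epsilon>" if "x \<in> ?K" for x
    proof -
      have "norm x * \<epsilon> \<le> (1 + norm x) * \<bar>schwartz_fun \<phi> x\<bar>"
        using that \<open>0 < \<epsilon>\<close> by (intro mult_mono) auto
      also have "\<dots> \<le> B" using B[of x] by (simp add: abs_mult)
      finally show ?thesis using \<open>0 < \<epsilon>\<close> by (simp add: field_simps)
    qed
    then have "bounded ?K" by (auto simp: bounded_iff)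
    moreover have "closed ?K"
      by (intro closed_Collect_le continuous_intros schwartz_fun_continuous)
    ultimately have "compact ?K" by (simp add: compact_eq_bounded_closed)
    then obtain x0 where x0: "x0 \<in> ?K" "\<And>x. x \<in> ?K \<Longrightarrow> schwartz_fun F x0 \<le> schwartz_fun F x"
      using continuous_attains_inf[of ?K "schwartz_fun F"] False
        continuous_on_subset[OF schwartz_fun_continuous] by blast
    define \<delta> where "\<delta> = schwartz_fun F x0"
    have \<delta>: "0 < \<delta>" "\<delta> \<le> 1"
      using x0(1) zeros[of x0] F[of x0] \<open>0 < \<epsilon>\<close> by (auto simp: \<delta>_def less_le)
    obtain n where n: "(1 - \<delta>) ^ n < \<epsilon> / (1 + sup_norm (schwartz_fun \<phi>))"
      using real_arch_pow_inv[of "\<epsilon> / (1 + sup_norm (schwartz_fun \<phi>))" "1 - \<delta>"] \<delta> \<open>0 < \<epsilon>\<close>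
        sup_norm_nonneg[of \<phi>] by (auto simp: add_pos_nonneg)
    have "\<bar>(1 - schwartz_fun F x) ^ n * schwartz_fun \<phi> x\<bar> \<le> \<epsilon>" if "x \<in> ?K" for x
    proof -
      have "\<bar>(1 - schwartz_fun F x) ^ n\<bar> \<le> (1 - \<delta>) ^ n"
        using F[of x] x0(2)[OF that] by (simp add: \<delta>_def power_mono)
      then have "\<bar>(1 - schwartz_fun F x) ^ n * schwartz_fun \<phi> x\<bar> \<le> (1 - \<delta>) ^ n * (1 + sup_norm (schwartz_fun \<phi>))"
        unfolding abs_mult using abs_le_sup_norm[of \<phi> x] \<delta> by (intro mult_mono) auto
      also have "\<dots> \<le> \<epsilon>"
        using n sup_norm_nonneg[of \<phi>] by (simp add: field_simps)
      finally show ?thesis .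
    qed
    with small show ?thesis by blast
  qed
qed

text \<open>Since \<open>w\<close> annihilates all multiples of \<open>F\<close>, it does not distinguish \<open>\<phi>\<close> from
\<open>(1 - F)\<^sup>n \<phi>\<close>, where \<open>F\<close> is scaled to be at most 1. These functions tend to 0 uniformly, and
\<open>w\<close> is continuous for the supremum norm. Only polynomials in \<open>F\<close> occur, so that all test
functions remain Schwartz functions.\<close>

lemma apply_eq_0_if_vanishing_on_zeros:
  assumes w: "M_norm w < \<infinity>"
    and ann: "\<And>\<psi>. apply_distr w (schwartz_mult F \<psi>) = 0"
    and F: "\<And>x. 0 \<le> schwartz_fun F x"
    and zeros: "\<And>x. schwartz_fun F x = 0 \<Longrightarrow> schwartz_fun \<phi> x = 0"
  shows "apply_distr w \<phi> = 0"
proof -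
  obtain r where r: "0 \<le> r" "M_norm w = ereal r" using M_norm_real[OF w] by blast
  obtain B where B: "0 < B" "\<And>x. \<bar>schwartz_fun F x\<bar> \<le> B"
    using schwartz_function_bounded[of "schwartz_fun F"] schwartz_fun[of F] by auto
  define E where "E = (1 / B) *\<^sub>R F"
  have E: "schwartz_fun E x = schwartz_fun F x / B" for x by (simp add: E_def scaleR_schwartz.rep_eq)
  have annE: "apply_distr w (schwartz_mult E \<psi>) = 0" for \<psi>
  proof -
    have "schwartz_mult E \<psi> = (1 / B) *\<^sub>R schwartz_mult F \<psi>" unfolding E_def by transfer (simp add: mult.assoc)
    then show ?thesis by (simp add: apply_distr_scale ann)
  qed
  have damped: "\<exists>\<theta>. apply_distr w \<theta> = apply_distr w \<phi> \<and>
      (\<forall>x. schwartz_fun \<theta> x = (1 - schwartz_fun E x) ^ n * schwartz_fun \<phi> x)" for n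
  proof (induction n)
    case (Suc n)
    then obtain \<theta> where "apply_distr w \<theta> = apply_distr w \<phi>"
      "\<And>x. schwartz_fun \<theta> x = (1 - schwartz_fun E x) ^ n * schwartz_fun \<phi> x" by blast
    then show ?case
      by (intro exI[of _ "\<theta> - schwartz_mult E \<theta>"])
         (simp add: apply_distr_diff annE minus_schwartz.rep_eq schwartz_mult.rep_eq algebra_simps)
  qed auto
  have "\<bar>apply_distr w \<phi>\<bar> \<le> 0 + e" if "0 < e" for e
  proof -
    have "0 < e / (1 + r)" using that r by simp
    moreover have "0 \<le> schwartz_fun E x" "schwartz_fun E x \<le> 1"
        "schwartz_fun E x = 0 \<Longrightarrow> schwartz_fun \<phi> x = 0" for x
      using F[of x] B(1) B(2)[of x] zeros[of x] by (auto simp: E)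
    ultimately obtain n where n: "\<And>x. \<bar>(1 - schwartz_fun E x) ^ n * schwartz_fun \<phi> x\<bar> \<le> e / (1 + r)"
      using damping_by_vanishing_factor[of E \<phi> "e / (1 + r)"] by blast
    obtain \<theta> where \<theta>: "apply_distr w \<theta> = apply_distr w \<phi>"
      "\<And>x. schwartz_fun \<theta> x = (1 - schwartz_fun E x) ^ n * schwartz_fun \<phi> x" using damped by blast
    have "\<bar>apply_distr w \<theta>\<bar> \<le> r * sup_norm (schwartz_fun \<theta>)"
      using r by (intro abs_apply_le_M_norm) simp
    also have "\<dots> \<le> r * (e / (1 + r))"
      using r n by (intro mult_left_mono sup_norm_le) (auto simp: \<theta>)
    also have "\<dots> \<le> e" using r that by (simp add: field_simps)
    finally show ?thesis by (simp add: \<theta>)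
  qed
  then have "\<bar>apply_distr w \<phi>\<bar> \<le> 0" by (rule field_le_epsilon)
  then show ?thesis by simp
qed

text \<open>The fragments of \<open>w\<close> span a space of dimension at most \<open>m\<close>. The condition is stated for
indexed families because it is used through the coefficients of a linear relation, and a family may
take the same value twice.\<close>

definition fragments_dependent :: "nat \<Rightarrow> 'd::finite tempered \<Rightarrow> bool" where
  "fragments_dependent m w \<longleftrightarrow> (\<forall>(I :: nat set) u. finite I \<longrightarrow> m < card I \<longrightarrow> u ` I \<subseteq> fragments w \<longrightarrow>
     (\<exists>c. (\<exists>i\<in>I. c i \<noteq> 0) \<and> (\<Sum>i\<in>I. c i *\<^sub>R u i) = 0))"

text \<open>Let \<open>h\<close> be the square of \<open>f\<close>, scaled to take values between 0 and 1. The products of \<open>w\<close> with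
\<open>h, h\<^sup>2, \<dots>\<close> are fragments, so \<open>m + 1\<close> of them are linearly dependent. Hence some nonzero
polynomial in \<open>h\<close> annihilates \<open>w\<close>, and \<open>f\<close> takes only finitely many values on its zero set.\<close>

lemma annihilating_polynomial:
  assumes w: "M_norm w < \<infinity>" and dep: "fragments_dependent m w" and f: "schwartz_function f"
  obtains q V where "\<And>\<phi>. apply_distr w (schwartz_mult q \<phi>) = 0" "finite V"
    "\<And>x. schwartz_fun q x = 0 \<Longrightarrow> f x \<in> V"
proof -
  obtain B where B: "0 < B" "\<And>x. \<bar>f x\<bar> \<le> B" using schwartz_function_bounded[OF f] by blast
  define h where "h x = ((1 / B) * f x) ^ Suc 1" for x
  have h: "schwartz_function h" unfolding h_def
    by (intro schwartz_function_power schwartz_function_scale f)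
  have h01: "0 \<le> h x" "h x \<le> 1" for x
  proof -
    have "\<bar>f x / B\<bar> \<le> 1" using B(1) B(2)[of x] by simp
    then have "(f x / B)\<^sup>2 \<le> 1" by (simp add: abs_square_le_1)
    then show "0 \<le> h x" "h x \<le> 1" by (simp_all add: h_def numeral_2_eq_2)
  qed
  have "\<exists>\<eta>. schwartz_fun \<eta> = (\<lambda>x. h x ^ Suc k)" for k
    by (intro schwartz_fun_exists schwartz_function_power h)
  then obtain \<eta> where \<eta>: "\<And>k. schwartz_fun (\<eta> k) = (\<lambda>x. h x ^ Suc k)" by metis
  have "localize (\<eta> k) w \<in> fragments w" for k
    using h01 by (intro localize_fragment w) (auto simp: \<eta> simp del: power_Suc intro: power_le_one)
  then obtain c k where c: "k \<le> m" "c k \<noteq> 0" "(\<Sum>k\<le>m. c k *\<^sub>R localize (\<eta> k) w) = 0"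
    using dep[unfolded fragments_dependent_def, rule_format, of "{..m}" "\<lambda>k. localize (\<eta> k) w"] by auto
  define q where "q = (\<Sum>k\<le>m. c k *\<^sub>R \<eta> k)"
  have q: "schwartz_fun q x = (\<Sum>k\<le>m. c k * h x ^ Suc k)" for x
    by (simp add: q_def sum_schwartz_fun scaleR_schwartz.rep_eq \<eta>)
  have ann: "apply_distr w (schwartz_mult q \<phi>) = 0" for \<phi>
  proof -
    have "schwartz_mult q \<phi> = (\<Sum>k\<le>m. c k *\<^sub>R schwartz_mult (\<eta> k) \<phi>)"
      by (rule schwartz_fun_eqI)
         (simp add: q_def schwartz_mult.rep_eq sum_schwartz_fun scaleR_schwartz.rep_eq sum_distrib_right mult.assoc)
    then have "apply_distr w (schwartz_mult q \<phi>) = apply_distr (\<Sum>k\<le>m. c k *\<^sub>R localize (\<eta> k) w) \<phi>"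
      by (simp add: apply_distr_sum apply_distr_scale sum_tempered_apply scaleR_tempered.rep_eq apply_localize[OF w])
    then show ?thesis using c(3) by (simp add: zero_tempered.rep_eq)
  qed
  \<comment> \<open>the powers start at 1, so the polynomial has constant coefficient 0\<close>
  define d where "d k = (case k of 0 \<Rightarrow> 0 | Suc j \<Rightarrow> c j)" for k
  let ?R = "{t. (\<Sum>k\<le>Suc m. d k * t ^ k) = 0}"
  have "finite ?R" using c(1,2) by (intro iffD2[OF polyfun_finite_roots] exI[of _ "Suc k"]) (simp add: d_def)
  then have "finite ((\<lambda>t. B * sqrt t) ` ?R \<union> (\<lambda>t. - (B * sqrt t)) ` ?R)" by simp
  moreover have "f x \<in> (\<lambda>t. B * sqrt t) ` ?R \<union> (\<lambda>t. - (B * sqrt t)) ` ?R" if "schwartz_fun q x = 0" for x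
  proof -
    have "h x \<in> ?R" using that unfolding q mem_Collect_eq sum.atMost_Suc_shift by (simp add: d_def)
    moreover have "sqrt (h x) = \<bar>f x\<bar> / B"
    proof -
      have "h x = (f x / B)\<^sup>2" by (simp add: h_def power2_eq_square)
      then show ?thesis using B(1) by (simp add: abs_divide)
    qed
    then have "f x = B * sqrt (h x) \<or> f x = - (B * sqrt (h x))" using B(1) by (simp add: abs_if)
    ultimately show ?thesis by blast
  qed
  ultimately show thesis using ann that by blast
qed


lemma finite_vec_image:
  fixes V :: "'d::finite \<Rightarrow> real set"
  assumes "\<And>i. finite (V i)"
  shows "finite {y :: real^'d. \<forall>i. y $ i \<in> V i}"
proof (rule finite_subset)
  show "{y. \<forall>i. y $ i \<in> V i} \<subseteq> vec_lambda ` (Pi\<^sub>E UNIV V)"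
  proof
    fix y :: "real^'d" assume "y \<in> {y. \<forall>i. y $ i \<in> V i}"
    then have "vec_nth y \<in> Pi\<^sub>E UNIV V" by auto
    then have "vec_lambda (vec_nth y) \<in> vec_lambda ` (Pi\<^sub>E UNIV V)" by (rule imageI)
    then show "y \<in> vec_lambda ` (Pi\<^sub>E UNIV V)" by simp
  qed
  show "finite (vec_lambda ` (Pi\<^sub>E UNIV V) :: (real^'d) set)"
    using assms by (intro finite_imageI finite_PiE) auto
qed

text \<open>The Gaussian and its products with the coordinates determine the point, because the Gaussian has no
zeros. Each of these functions takes only finitely many values on the zeros of some annihilator of
\<open>w\<close>; the sum of the squares of these annihilators vanishes only where all of them do.\<close>

lemma annihilator_with_finite_zero_set:
  fixes w :: "'d::finite tempered"
  assumes w: "M_norm w < \<infinity>" and dep: "fragments_dependent m w"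
  obtains F where "\<And>\<phi>. apply_distr w (schwartz_mult F \<phi>) = 0" "\<And>x. 0 \<le> schwartz_fun F x"
    "finite {x. schwartz_fun F x = 0}"
proof -
  obtain q V where q: "\<And>\<phi>. apply_distr w (schwartz_mult q \<phi>) = 0" "finite V"
    "\<And>x. schwartz_fun q x = 0 \<Longrightarrow> gaussian x \<in> V"
    using annihilating_polynomial[OF w dep schwartz_function_gaussian] by blast
  have "\<exists>q V. (\<forall>\<phi>. apply_distr w (schwartz_mult q \<phi>) = 0) \<and> finite V \<and>
      (\<forall>x. schwartz_fun q x = 0 \<longrightarrow> x $ i * gaussian x \<in> V)" for i
  proof -
    have "schwartz_function (\<lambda>x. x $ i * gaussian x)"
      by (intro schwartz_function_polynomial_gaussian real_polynomial_function.intros(1) bounded_linear_vec_nth)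
    from annihilating_polynomial[OF w dep this] show ?thesis by metis
  qed
  then obtain p U where p: "\<And>i \<phi>. apply_distr w (schwartz_mult (p i) \<phi>) = 0" "\<And>i. finite (U i)"
    "\<And>i x. schwartz_fun (p i) x = 0 \<Longrightarrow> x $ i * gaussian x \<in> U i" by metis
  define F where "F = schwartz_mult q q + (\<Sum>i\<in>UNIV. schwartz_mult (p i) (p i))"
  have F: "schwartz_fun F x = (schwartz_fun q x)\<^sup>2 + (\<Sum>i\<in>UNIV. (schwartz_fun (p i) x)\<^sup>2)" for x
    by (simp add: F_def plus_schwartz.rep_eq sum_schwartz_fun schwartz_mult.rep_eq power2_eq_square)
  have "apply_distr w (schwartz_mult F \<phi>) = 0" for \<phi>
  proof -
    have "schwartz_mult F \<phi> = schwartz_mult q (schwartz_mult q \<phi>)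
        + (\<Sum>i\<in>UNIV. schwartz_mult (p i) (schwartz_mult (p i) \<phi>))"
      by (rule schwartz_fun_eqI)
         (simp add: F_def plus_schwartz.rep_eq sum_schwartz_fun schwartz_mult.rep_eq distrib_right
            sum_distrib_right mult.assoc)
    then show ?thesis by (simp add: apply_distr_add apply_distr_sum q p)
  qed
  moreover have "0 \<le> schwartz_fun F x" for x unfolding F by (intro add_nonneg_nonneg sum_nonneg) auto
  moreover have "finite {x. schwartz_fun F x = 0}"
  proof (rule finite_subset)
    let ?Y = "{y :: real^'d. \<forall>i. y $ i \<in> U i}"
    show "{x. schwartz_fun F x = 0} \<subseteq> (\<lambda>(t, y). (1 / t) *\<^sub>R y) ` (V \<times> ?Y)"
    proof
      fix x assume "x \<in> {x. schwartz_fun F x = 0}"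
      then have "schwartz_fun F x = 0" by simp
      moreover have "0 \<le> (\<Sum>i\<in>UNIV. (schwartz_fun (p i) x)\<^sup>2)" by (intro sum_nonneg) auto
      ultimately have "schwartz_fun q x = 0" "(\<Sum>i\<in>UNIV. (schwartz_fun (p i) x)\<^sup>2) = 0"
        unfolding F by (auto simp: add_nonneg_eq_0_iff)
      then have "schwartz_fun q x = 0" "\<And>i. schwartz_fun (p i) x = 0"
        by (auto simp: sum_nonneg_eq_0_iff)
      then have "(gaussian x, gaussian x *\<^sub>R x) \<in> V \<times> ?Y"
        using q(3) p(3) by (auto simp: mult.commute)
      then have "(\<lambda>(t, y). (1 / t) *\<^sub>R y) (gaussian x, gaussian x *\<^sub>R x) \<in> (\<lambda>(t, y). (1 / t) *\<^sub>R y) ` (V \<times> ?Y)"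
        by (rule imageI)
      then show "x \<in> (\<lambda>(t, y). (1 / t) *\<^sub>R y) ` (V \<times> ?Y)" using gaussian_pos[of x] by simp
    qed
    show "finite ((\<lambda>(t, y). (1 / t) *\<^sub>R y) ` (V \<times> ?Y))"
      using q(2) finite_vec_image[of U] p(2) by auto
  qed
  ultimately show thesis using that by blast
qed

text \<open>Multiply the squared distances to the other points, as in Lagrange interpolation, and restore decay by
a Gaussian factor.\<close>

lemma schwartz_lagrange_basis:
  fixes Z :: "(real^'d::finite) set"
  assumes "finite Z"
  obtains l :: "real^'d \<Rightarrow> 'd schwartz" where "\<And>z x. 0 \<le> schwartz_fun (l z) x" "\<And>z x. schwartz_fun (l z) x \<le> 1"
    "\<And>z. 0 < schwartz_fun (l z) z" "\<And>z y. y \<in> Z \<Longrightarrow> y \<noteq> z \<Longrightarrow> schwartz_fun (l z) y = 0"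
proof -
  have "\<exists>l. (\<forall>x. 0 \<le> schwartz_fun l x \<and> schwartz_fun l x \<le> 1) \<and> 0 < schwartz_fun l z \<and>
      (\<forall>y\<in>Z. y \<noteq> z \<longrightarrow> schwartz_fun l y = 0)" for z
  proof -
    let ?f = "\<lambda>x. (\<Prod>y\<in>Z - {z}. (x - y) \<bullet> (x - y)) * gaussian x"
    have "real_polynomial_function (\<lambda>x. x \<bullet> x - 2 * (x \<bullet> y) + y \<bullet> y)" for y :: "real^'d"
      by (intro real_polynomial_function.intros(2-4) real_polynomial_function_diff
            real_polynomial_function_inner_self real_polynomial_function.intros(1) bounded_linear_inner_left)
    moreover have "x \<bullet> x - 2 * (x \<bullet> y) + y \<bullet> y = (x - y) \<bullet> (x - y)" for x y :: "real^'d"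
      by (simp add: inner_diff_left inner_diff_right inner_commute)
    ultimately have poly: "real_polynomial_function (\<lambda>x. (x - y) \<bullet> (x - y))" for y :: "real^'d" by simp
    have f: "schwartz_function ?f"
      using assms by (intro schwartz_function_polynomial_gaussian real_polynomial_function_prod poly) auto
    have f0: "0 \<le> ?f x" for x using gaussian_pos[of x] by (intro mult_nonneg_nonneg prod_nonneg) auto
    obtain B where B: "0 < B" "\<And>x. \<bar>?f x\<bar> \<le> B" using schwartz_function_bounded[OF f] by blast
    obtain l where l: "schwartz_fun l = (\<lambda>x. (1 / B) * ?f x)"
      using schwartz_fun_exists[OF schwartz_function_scale[OF f]] by blast
    have "0 \<le> schwartz_fun l x \<and> schwartz_fun l x \<le> 1" for x
      using f0[of x] B(1) B(2)[of x] unfolding l by simp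
    moreover have "0 < schwartz_fun l z"
      unfolding l using B(1) gaussian_pos[of z] by (intro mult_pos_pos prod_pos) auto
    moreover have "schwartz_fun l y = 0" if "y \<in> Z" "y \<noteq> z" for y
    proof -
      have "(\<Prod>v\<in>Z - {z}. (y - v) \<bullet> (y - v)) = 0"
        using that assms by (intro prod_zero bexI[of _ y]) auto
      then show ?thesis unfolding l by simp
    qed
    ultimately show ?thesis by blast
  qed
  then show thesis using that by metis
qed

text \<open>Let \<open>F\<close> annihilate \<open>w\<close> and have a finite zero set. Interpolating a test function on this set by
the Lagrange functions changes it by a function that vanishes there, so \<open>w\<close> only sees the values at
these points and is a combination of Dirac impulses. The products of \<open>w\<close> with the Lagrange functions
of those points that carry mass are linearly independent fragments, which bounds their number.\<close>

lemma sum_of_diracs_if_fragments_dependent: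
  fixes w :: "'d::finite tempered"
  assumes w: "M_norm w < \<infinity>" and dep: "fragments_dependent m w"
  obtains Z a where "finite Z" "card Z \<le> m" "w = (\<Sum>z\<in>Z. a z *\<^sub>R dirac z)"
proof -
  obtain F where F: "\<And>\<phi>. apply_distr w (schwartz_mult F \<phi>) = 0" "\<And>x. 0 \<le> schwartz_fun F x"
    and finF: "finite {x. schwartz_fun F x = 0}" (is "finite ?Y")
    using annihilator_with_finite_zero_set[OF w dep] by blast
  obtain l where l: "\<And>z x. 0 \<le> schwartz_fun (l z) x" "\<And>z x. schwartz_fun (l z) x \<le> 1"
    "\<And>z. 0 < schwartz_fun (l z) z" "\<And>z y. y \<in> ?Y \<Longrightarrow> y \<noteq> z \<Longrightarrow> schwartz_fun (l z) y = 0"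
    using schwartz_lagrange_basis[OF finF] by blast
  define a where "a z = apply_distr w (l z) / schwartz_fun (l z) z" for z
  define Z where "Z = {z \<in> ?Y. a z \<noteq> 0}"
  have Z: "finite Z" using finF by (simp add: Z_def)
  have w_eq: "apply_distr w \<phi> = (\<Sum>z\<in>Z. a z * schwartz_fun \<phi> z)" for \<phi>
  proof -
    let ?\<theta> = "\<phi> - (\<Sum>z\<in>?Y. (schwartz_fun \<phi> z / schwartz_fun (l z) z) *\<^sub>R l z)"
    have "schwartz_fun ?\<theta> x = 0" if "schwartz_fun F x = 0" for x
    proof -
      have "(\<Sum>z\<in>?Y. schwartz_fun \<phi> z / schwartz_fun (l z) z * schwartz_fun (l z) x) =
          (\<Sum>z\<in>{x}. schwartz_fun \<phi> z / schwartz_fun (l z) z * schwartz_fun (l z) x)"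
        using that finF l(4) by (intro sum.mono_neutral_right) auto
      then show ?thesis
        using l(3)[of x] by (simp add: minus_schwartz.rep_eq sum_schwartz_fun scaleR_schwartz.rep_eq)
    qed
    then have "apply_distr w ?\<theta> = 0"
      by (intro apply_eq_0_if_vanishing_on_zeros[OF w F]) auto
    then have "apply_distr w \<phi> = (\<Sum>z\<in>?Y. a z * schwartz_fun \<phi> z)"
      by (simp add: apply_distr_diff apply_distr_sum apply_distr_scale a_def mult.commute)
    also have "\<dots> = (\<Sum>z\<in>Z. a z * schwartz_fun \<phi> z)"
      using finF by (intro sum.mono_neutral_right) (auto simp: Z_def)
    finally show ?thesis .
  qed
  have "card Z \<le> m"
  proof (rule ccontr)
    assume "\<not> card Z \<le> m"
    obtain h where h: "bij_betw h {0..<card Z} Z" using ex_bij_betw_nat_finite[OF Z] by blast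
    let ?u = "\<lambda>k. localize (l (h k)) w"
    have "?u ` {0..<card Z} \<subseteq> fragments w" using l by (auto intro!: localize_fragment w)
    then have "\<exists>c. (\<exists>i\<in>{0..<card Z}. c i \<noteq> 0) \<and> (\<Sum>i\<in>{0..<card Z}. c i *\<^sub>R ?u i) = 0"
      using dep[unfolded fragments_dependent_def, rule_format, of "{0..<card Z}" ?u] \<open>\<not> card Z \<le> m\<close>
      by simp
    then obtain c j where
      c: "j < card Z" "c j \<noteq> 0" "(\<Sum>k\<in>{0..<card Z}. c k *\<^sub>R ?u k) = 0" by auto
    have hZ: "h k \<in> Z" if "k < card Z" for k using h that by (auto simp: bij_betw_def)
    have Y: "z \<in> Z \<Longrightarrow> z \<in> ?Y" for z by (simp add: Z_def)
    have orth: "apply_distr (?u k) (l (h j)) = (if k = j then a (h j) * (schwartz_fun (l (h j)) (h j))\<^sup>2 else 0)"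
      if "k < card Z" for k
    proof -
      have "apply_distr (?u k) (l (h j)) = (\<Sum>z\<in>Z. a z * (schwartz_fun (l (h k)) z * schwartz_fun (l (h j)) z))"
        by (simp add: apply_localize[OF w] w_eq schwartz_mult.rep_eq)
      also have "\<dots> = (\<Sum>z\<in>{h j}. a z * (schwartz_fun (l (h k)) z * schwartz_fun (l (h j)) z))"
        using Z hZ[OF c(1)] l(4)[OF Y] by (intro sum.mono_neutral_right) auto
      also have "\<dots> = (if k = j then a (h j) * (schwartz_fun (l (h j)) (h j))\<^sup>2 else 0)"
      proof (cases "k = j")
        case False
        then have "h j \<noteq> h k" using h that c(1) by (auto simp: bij_betw_def inj_on_def)
        then show ?thesis using False l(4)[OF Y[OF hZ[OF c(1)]]] by simp
      qed (simp add: power2_eq_square)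
      finally show ?thesis .
    qed
    have "0 = apply_distr (\<Sum>k\<in>{0..<card Z}. c k *\<^sub>R ?u k) (l (h j))"
      using c(3) by (simp add: zero_tempered.rep_eq)
    also have "\<dots> = (\<Sum>k\<in>{0..<card Z}. c k * apply_distr (?u k) (l (h j)))"
      by (simp add: sum_tempered_apply scaleR_tempered.rep_eq)
    also have "\<dots> = (\<Sum>k\<in>{0..<card Z}. if k = j then c j * (a (h j) * (schwartz_fun (l (h j)) (h j))\<^sup>2) else 0)"
      by (intro sum.cong) (auto simp: orth)
    also have "\<dots> = c j * (a (h j) * (schwartz_fun (l (h j)) (h j))\<^sup>2)" using c(1) by simp
    finally show False using c(2) hZ[OF c(1)] l(3)[of "h j"] by (auto simp: Z_def)
  qed
  moreover have "w = (\<Sum>z\<in>Z. a z *\<^sub>R dirac z)"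
    by (rule tempered_eqI) (simp add: w_eq sum_tempered_apply scaleR_tempered.rep_eq dirac.rep_eq)
  ultimately show thesis using Z that by blast
qed


section \<open>Extreme points of the solution set\<close>

lemma exists_linear_relation:
  fixes v :: "'i \<Rightarrow> 'a::euclidean_space"
  assumes "finite J" "DIM('a) < card J"
  shows "\<exists>c. (\<exists>j\<in>J. c j \<noteq> 0) \<and> (\<Sum>j\<in>J. c j *\<^sub>R v j) = 0"
proof (cases "inj_on v J")
  case True
  then have "dependent (v ` J)" using assms by (intro dependent_biggerset) (simp add: card_image)
  then obtain c where "\<exists>x\<in>v ` J. c x \<noteq> 0" "(\<Sum>x\<in>v ` J. c x *\<^sub>R x) = 0"
    using assms(1) by (auto simp: dependent_finite)
  then show ?thesis using True by (intro exI[of _ "c \<circ> v"]) (simp add: sum.reindex)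
next
  case False
  then obtain i j where ij: "i \<in> J" "j \<in> J" "i \<noteq> j" "v i = v j" by (auto simp: inj_on_def)
  let ?c = "\<lambda>k. if k = i then 1 else if k = j then - 1 else 0 :: real"
  have "(\<Sum>k\<in>J. ?c k *\<^sub>R v k) = (\<Sum>k\<in>{i, j}. ?c k *\<^sub>R v k)"
    using assms(1) ij by (intro sum.mono_neutral_right) auto
  also have "\<dots> = 0" using ij by simp
  finally show ?thesis using ij(1) by (intro exI[of _ ?c] conjI bexI[of _ i]) auto
qed

lemma linear_on_subspace_sum:
  assumes "linear_on_subspace V T" "\<And>i. i \<in> I \<Longrightarrow> x i \<in> V"
  shows "(\<Sum>i\<in>I. c i *\<^sub>R x i) \<in> V" "T (\<Sum>i\<in>I. c i *\<^sub>R x i) = (\<Sum>i\<in>I. c i *\<^sub>R T (x i))"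
proof -
  have V: "subspace V" and T: "\<And>x y. x \<in> V \<Longrightarrow> y \<in> V \<Longrightarrow> T (x + y) = T x + T y"
    "\<And>c x. x \<in> V \<Longrightarrow> T (c *\<^sub>R x) = c *\<^sub>R T x"
    using assms(1) by (auto simp: linear_on_subspace_def)
  show mem: "(\<Sum>i\<in>I. c i *\<^sub>R x i) \<in> V"
    using assms(2) by (intro subspace_sum[OF V] subspace_scale[OF V])
  have "T 0 = 0" using T(2)[OF subspace_0[OF V], of 0] by simp
  then show "T (\<Sum>i\<in>I. c i *\<^sub>R x i) = (\<Sum>i\<in>I. c i *\<^sub>R T (x i))"
    using assms(2)
    by (induction I rule: infinite_finite_induct)
       (simp_all add: T subspace_sum[OF V] subspace_scale[OF V])
qed

lemma linear_on_subspace_add: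
  assumes "linear_on_subspace V T" "x \<in> V" "y \<in> V"
  shows "x + y \<in> V" "T (x + y) = T x + T y"
  using assms by (auto simp: linear_on_subspace_def intro: subspace_add)

lemma linear_on_subspace_scale:
  assumes "linear_on_subspace V T" "x \<in> V"
  shows "c *\<^sub>R x \<in> V" "T (c *\<^sub>R x) = c *\<^sub>R T x"
  using assms by (auto simp: linear_on_subspace_def intro: subspace_scale)

lemma independent_family_sum_eq_0:
  fixes v :: "'i \<Rightarrow> 'a::real_vector"
  assumes "finite I" "inj_on v I" "independent (v ` I)" "(\<Sum>i\<in>I. c i *\<^sub>R v i) = 0" "i \<in> I"
  shows "c i = 0"
proof -
  have "(\<Sum>x\<in>v ` I. c (inv_into I v x) *\<^sub>R x) = 0"
    using assms by (simp add: sum.reindex)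
  then have "c (inv_into I v (v i)) = 0"
    using independentD[OF assms(3) finite_imageI[OF assms(1)] subset_refl, of "\<lambda>x. c (inv_into I v x)" "v i"] assms(5)
    by simp
  then show ?thesis using assms(2,5) by simp
qed

lemma span_family:
  fixes v :: "'i \<Rightarrow> 'a::real_vector"
  assumes "finite I" "inj_on v I" "x \<in> span (v ` I)"
  obtains c where "x = (\<Sum>i\<in>I. c i *\<^sub>R v i)"
proof -
  obtain c where "x = (\<Sum>y\<in>v ` I. c y *\<^sub>R y)"
    using assms(1,3) by (auto simp: span_finite)
  then have "x = (\<Sum>i\<in>I. c (v i) *\<^sub>R v i)" using assms(2) by (simp add: sum.reindex)
  then show thesis by (rule that)
qed

lemma extreme_point_direction_0:
  fixes x h :: "'a::real_vector"
  assumes "x extreme_point_of S" "x + h \<in> S" "x - h \<in> S"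
  shows "h = 0"
proof (rule ccontr)
  assume "h \<noteq> 0"
  have "x - h \<noteq> x + h"
  proof
    assume "x - h = x + h"
    then have "(2::real) *\<^sub>R h = 0" by (simp add: scaleR_2 algebra_simps)
    with \<open>h \<noteq> 0\<close> show False by simp
  qed
  moreover have "x = (1 - 1/2) *\<^sub>R (x - h) + (1/2) *\<^sub>R (x + h)"
    by (simp add: algebra_simps flip: scaleR_add_left)
  ultimately have "x \<in> open_segment (x - h) (x + h)"
    unfolding in_segment by (intro conjI exI[of _ "1/2"]) auto
  then show False using assms by (auto simp: extreme_point_of_def)
qed

text \<open>The norm of \<open>w\<close> is affine along the directions spanned by fragments: with \<open>n\<^sub>i\<close> the norm of
\<open>u\<^sub>i\<close>, the deviation of \<open>\<Sum>i. c\<^sub>i u\<^sub>i\<close> from \<open>\<Sum>i. c\<^sub>i n\<^sub>i\<close> is at most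
\<open>\<Sum>i. \<bar>c\<^sub>i\<bar>\<close> times the deficit of \<open>w\<close> at the test function, and is absorbed by this
deficit once the step \<open>\<epsilon>\<close> is small. Both signs of the step are possible, with opposite slopes.\<close>

lemma perturbation_by_fragments:
  fixes w :: "'d::finite tempered"
  assumes w: "M_norm w = ereal r" and I: "finite I" "\<And>i. i \<in> I \<Longrightarrow> u i \<in> fragments w"
  obtains \<epsilon> \<tau> where "0 < \<epsilon>" "M_norm (w + \<epsilon> *\<^sub>R (\<Sum>i\<in>I. c i *\<^sub>R u i)) \<le> ereal (r + \<tau>)"
    "M_norm (w - \<epsilon> *\<^sub>R (\<Sum>i\<in>I. c i *\<^sub>R u i)) \<le> ereal (r - \<tau>)"
proof -
  let ?S = "\<lambda>\<phi>. sup_norm (schwartz_fun \<phi>)"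
  have "\<forall>i\<in>I. \<exists>n. \<forall>\<phi>. \<bar>apply_distr (u i) \<phi> - n * ?S \<phi>\<bar> \<le> r * ?S \<phi> - apply_distr w \<phi>"
    using fragment_deviation[OF w I(2)] by metis
  then obtain n where n: "\<And>i \<phi>. i \<in> I \<Longrightarrow> \<bar>apply_distr (u i) \<phi> - n i * ?S \<phi>\<bar> \<le> r * ?S \<phi> - apply_distr w \<phi>"
    by metis
  define \<epsilon> where "\<epsilon> = 1 / (1 + (\<Sum>i\<in>I. \<bar>c i\<bar>))"
  define T where "T = (\<Sum>i\<in>I. c i * n i)"
  let ?h = "\<Sum>i\<in>I. c i *\<^sub>R u i"
  have pos: "0 < 1 + (\<Sum>i\<in>I. \<bar>c i\<bar>)" by (intro add_pos_nonneg sum_nonneg) auto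
  have \<epsilon>: "0 < \<epsilon>" "\<epsilon> * (\<Sum>i\<in>I. \<bar>c i\<bar>) \<le> 1" using pos by (simp_all add: \<epsilon>_def)
  have key: "\<bar>\<epsilon> * (apply_distr ?h \<phi> - T * ?S \<phi>)\<bar> \<le> r * ?S \<phi> - apply_distr w \<phi>" for \<phi>
  proof -
    let ?d = "r * ?S \<phi> - apply_distr w \<phi>"
    have d: "0 \<le> ?d" using apply_le_M_norm[of w r \<phi>] w by simp
    have "apply_distr ?h \<phi> - T * ?S \<phi> = (\<Sum>i\<in>I. c i * (apply_distr (u i) \<phi> - n i * ?S \<phi>))"
      by (simp add: sum_tempered_apply scaleR_tempered.rep_eq T_def sum_distrib_right right_diff_distrib
          sum_subtractf mult.assoc)
    also have "\<bar>\<dots>\<bar> \<le> (\<Sum>i\<in>I. \<bar>c i\<bar> * ?d)"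
      using n by (intro order_trans[OF sum_abs] sum_mono) (auto simp: abs_mult intro!: mult_left_mono)
    finally have "\<bar>apply_distr ?h \<phi> - T * ?S \<phi>\<bar> \<le> (\<Sum>i\<in>I. \<bar>c i\<bar>) * ?d"
      by (simp add: sum_distrib_right)
    then have "\<epsilon> * \<bar>apply_distr ?h \<phi> - T * ?S \<phi>\<bar> \<le> \<epsilon> * ((\<Sum>i\<in>I. \<bar>c i\<bar>) * ?d)"
      using \<epsilon>(1) by (intro mult_left_mono) auto
    also have "\<dots> \<le> 1 * ?d" using mult_right_mono[OF \<epsilon>(2) d] by (simp add: mult.assoc)
    finally show ?thesis using \<epsilon>(1) by (simp add: abs_mult)
  qed
  show thesis
  proof (rule that[of \<epsilon> "\<epsilon> * T"])
    show "M_norm (w + \<epsilon> *\<^sub>R ?h) \<le> ereal (r + \<epsilon> * T)"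
    proof (rule M_norm_le)
      fix \<phi> :: "'d schwartz" assume "?S \<phi> = 1"
      then show "apply_distr (w + \<epsilon> *\<^sub>R ?h) \<phi> \<le> r + \<epsilon> * T"
        using key[of \<phi>] by (simp add: plus_tempered.rep_eq scaleR_tempered.rep_eq right_diff_distrib)
    qed
    show "M_norm (w - \<epsilon> *\<^sub>R ?h) \<le> ereal (r - \<epsilon> * T)"
    proof (rule M_norm_le)
      fix \<phi> :: "'d schwartz" assume "?S \<phi> = 1"
      then show "apply_distr (w - \<epsilon> *\<^sub>R ?h) \<phi> \<le> r - \<epsilon> * T"
        using key[of \<phi>] by (simp add: minus_tempered.rep_eq scaleR_tempered.rep_eq right_diff_distrib)
    qed
  qed (rule \<epsilon>(1))
qed

lemma null_space_subset_native_space: "null_space D L \<rho> \<subseteq> native_space D L \<rho>"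
proof -
  have "M_norm (0 :: 'a tempered) \<le> ereal 0"
    by (rule M_norm_le) (simp add: zero_tempered.rep_eq)
  then have "M_norm (0 :: 'a tempered) < \<infinity>" by (rule order.strict_trans1) simp
  then show ?thesis by (auto simp: null_space_def native_space_def)
qed

text \<open>The measurements of the functions \<open>Linv (u i)\<close> and of the basis of the null space are more vectors
than the dimension of the measurement space, hence some nontrivial combination \<open>h\<close> has measurement 0.
The norm of \<open>L (s + t h)\<close> is affine for small \<open>t\<close> of either sign and minimal at 0, hence
constant, so \<open>s + t h\<close> and \<open>s - t h\<close> are solutions and \<open>h = 0\<close> by extremality. Applying
\<open>L\<close> yields the relation. It is nontrivial, since otherwise the basis of the null space would be
linearly dependent. Counting the null space among the vectors is what turns the bound
\<open>CARD('m)\<close> on the number of knots into \<open>CARD('m) - N0\<close>.\<close>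

lemma extreme_point_fragments_relation:
  fixes L Linv :: "'d::finite tempered \<Rightarrow> 'd tempered"
    and \<nu> :: "'d tempered \<Rightarrow> real^'m::finite"
  assumes L: "linear_on_subspace D L"
    and basis: "null_space_basis D L \<rho> N0 p"
    and inverse: "right_inverse D L \<rho> N0 \<phi> Linv"
    and \<nu>: "linear_on_subspace (native_space D L \<rho>) \<nu>"
    and s: "s extreme_point_of interpolation_solutions D L \<rho> \<nu> y"
    and I: "finite I" "u ` I \<subseteq> fragments (L s)" "CARD('m) < card I + N0"
  shows "\<exists>c. (\<exists>i\<in>I. c i \<noteq> 0) \<and> (\<Sum>i\<in>I. c i *\<^sub>R u i) = 0"
proof -
  let ?N = "native_space D L \<rho>" and ?P = "\<lambda>n. fun_distr (p n)"
  have "s \<in> interpolation_solutions D L \<rho> \<nu> y" using s by (simp add: extreme_point_of_def)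
  then have sN: "s \<in> ?N" and sy: "\<nu> s = y"
    and smin: "\<And>f. f \<in> ?N \<Longrightarrow> \<nu> f = y \<Longrightarrow> M_norm (L s) \<le> M_norm (L f)"
    by (auto simp: interpolation_solutions_def is_arg_min_linorder)
  have ND: "?N \<subseteq> D" by (auto simp: native_space_def)
  have LN: "linear_on_subspace ?N L"
    using L \<nu> ND unfolding linear_on_subspace_def by blast
  obtain r where r: "M_norm (L s) = ereal r"
    using sN M_norm_real[of "L s"] by (auto simp: native_space_def)
  have uM: "u i \<in> M_space" if i: "i \<in> I" for i
  proof -
    have "u i \<in> fragments (L s)" using I(2) i by auto
    then obtain n where "M_norm (u i) = ereal n" using fragment_deviation[OF r] by blast
    then show ?thesis by (simp add: M_space_def)
  qed
  have Linv: "Linv (u i) \<in> ?N" "L (Linv (u i)) = u i" if "i \<in> I" for i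
    using inverse uM[OF that] by (auto simp: right_inverse_def)
  have P_null: "?P n \<in> null_space D L \<rho>" if "n \<in> {1..N0}" for n
    using basis that span_superset[of "?P ` {1..N0}"] by (auto simp: null_space_basis_def)
  have P: "?P n \<in> ?N" "L (?P n) = 0" if "n \<in> {1..N0}" for n
    using P_null[OF that] null_space_subset_native_space[of D L \<rho>] by (auto simp: null_space_def)
  define v where "v j = (case j of Inl i \<Rightarrow> Linv (u i) | Inr n \<Rightarrow> ?P n)" for j
  have J: "finite (I <+> {1..N0})" "DIM(real^'m) < card (I <+> {1..N0})"
    using I by (simp_all add: card_Plus)
  have vN: "v j \<in> ?N" if "j \<in> I <+> {1..N0}" for j using that Linv P by (auto simp: v_def)
  obtain c where c: "\<exists>j\<in>I <+> {1..N0}. c j \<noteq> 0" "(\<Sum>j\<in>I <+> {1..N0}. c j *\<^sub>R \<nu> (v j)) = 0"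
    using exists_linear_relation[OF J, of "\<lambda>j. \<nu> (v j)"] by blast
  define h where "h = (\<Sum>j\<in>I <+> {1..N0}. c j *\<^sub>R v j)"
  have hN: "h \<in> ?N" and \<nu>h: "\<nu> h = 0"
    using linear_on_subspace_sum[where I = "I <+> {1..N0}" and c = c and x = v, OF \<nu> vN] c(2) by (simp_all add: h_def)
  have h_eq: "h = (\<Sum>i\<in>I. c (Inl i) *\<^sub>R Linv (u i)) + (\<Sum>n\<in>{1..N0}. c (Inr n) *\<^sub>R ?P n)"
    using I(1) by (simp add: h_def sum.Plus v_def)
  have Lh: "L h = (\<Sum>i\<in>I. c (Inl i) *\<^sub>R u i)"
    using I(1) linear_on_subspace_sum(2)[where I = "I <+> {1..N0}" and c = c and x = v, OF LN vN]
    by (simp add: h_def sum.Plus v_def Linv P)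
  obtain \<epsilon> \<tau> where \<epsilon>: "0 < \<epsilon>" and plus: "M_norm (L s + \<epsilon> *\<^sub>R L h) \<le> ereal (r + \<tau>)"
    and minus: "M_norm (L s - \<epsilon> *\<^sub>R L h) \<le> ereal (r - \<tau>)"
    using perturbation_by_fragments[OF r I(1), of u "\<lambda>i. c (Inl i)"] I(2) unfolding Lh by blast
  have cand: "s + t *\<^sub>R h \<in> ?N \<and> \<nu> (s + t *\<^sub>R h) = y \<and> L (s + t *\<^sub>R h) = L s + t *\<^sub>R L h" for t
    using linear_on_subspace_scale[OF \<nu> hN, of t] linear_on_subspace_scale[OF LN hN, of t]
      linear_on_subspace_add[OF \<nu> sN, of "t *\<^sub>R h"] linear_on_subspace_add[OF LN sN, of "t *\<^sub>R h"]
    by (simp add: sy \<nu>h)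
  have "ereal r \<le> M_norm (L s + \<epsilon> *\<^sub>R L h)" "ereal r \<le> M_norm (L s - \<epsilon> *\<^sub>R L h)"
    using smin[of "s + \<epsilon> *\<^sub>R h"] smin[of "s + (- \<epsilon>) *\<^sub>R h"] cand[of \<epsilon>] cand[of "- \<epsilon>"] r by auto
  then have "ereal r \<le> ereal (r + \<tau>)" "ereal r \<le> ereal (r - \<tau>)"
    by (blast intro: order_trans plus minus)+
  then have "\<tau> = 0" by simp
  then have "M_norm (L (s + \<epsilon> *\<^sub>R h)) \<le> M_norm (L s)" "M_norm (L (s + (- \<epsilon>) *\<^sub>R h)) \<le> M_norm (L s)"
    using plus minus cand[of \<epsilon>] cand[of "- \<epsilon>"] r by auto
  then have "s + \<epsilon> *\<^sub>R h \<in> interpolation_solutions D L \<rho> \<nu> y" "s + (- \<epsilon>) *\<^sub>R h \<in> interpolation_solutions D L \<rho> \<nu> y"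
    using cand[of \<epsilon>] cand[of "- \<epsilon>"] smin
    by (auto simp: interpolation_solutions_def is_arg_min_linorder intro: order_trans)
  then have "\<epsilon> *\<^sub>R h = 0" using extreme_point_direction_0[OF s, of "\<epsilon> *\<^sub>R h"] by simp
  then have h0: "h = 0" using \<epsilon> by simp
  have "(\<Sum>i\<in>I. c (Inl i) *\<^sub>R u i) = 0"
    using linear_on_subspace_scale(2)[OF LN hN, of 0] h0 Lh by simp
  moreover have "\<exists>i\<in>I. c (Inl i) \<noteq> 0"
  proof (rule ccontr)
    assume "\<not> (\<exists>i\<in>I. c (Inl i) \<noteq> 0)"
    then have zero: "\<And>i. i \<in> I \<Longrightarrow> c (Inl i) = 0" by blast
    then have "(\<Sum>n\<in>{1..N0}. c (Inr n) *\<^sub>R ?P n) = 0" using h0 h_eq by simp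
    then have "c (Inr n) = 0" if "n \<in> {1..N0}" for n
      using independent_family_sum_eq_0[of "{1..N0}" ?P "\<lambda>n. c (Inr n)"] basis that
      by (auto simp: null_space_basis_def)
    with zero c(1) show False by auto
  qed
  ultimately show ?thesis by (intro exI[of _ "\<lambda>i. c (Inl i)"]) simp
qed

lemma subspace_fun_distr_L_inf: "subspace (fun_distr ` L_inf (real n))"
proof (rule subspaceI)
  have "fun_distr (\<lambda>x. 0) = 0"
    using fun_distr_scale[OF L_inf_zero, of 0] by simp
  then show "0 \<in> fun_distr ` L_inf (real n)" using L_inf_zero by (metis imageI)
qed (auto simp: fun_distr_add[symmetric] fun_distr_scale[symmetric] intro!: imageI L_inf_add L_inf_scale)

lemma shift_dirac: "shift x (dirac 0) = dirac x"
  by (rule tempered_eqI) (simp add: shift.rep_eq dirac.rep_eq schwartz_shift.rep_eq)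

theorem theorem2:
  fixes D :: "'d::finite tempered set"
    and L Linv :: "'d tempered \<Rightarrow> 'd tempered"
    and \<rho> :: "real^'d \<Rightarrow> real"
    and N0 :: nat
    and p :: "nat \<Rightarrow> real^'d \<Rightarrow> real"
    and \<phi> :: "nat \<Rightarrow> 'd tempered \<Rightarrow> real"
    and \<nu> :: "'d tempered \<Rightarrow> real^'m::finite"
    and y :: "real^'m"
  assumes "spline_admissible D L \<rho>"
    and "biorthogonal_system D L \<rho> N0 \<phi> p"
    and "right_inverse D L \<rho> N0 \<phi> Linv"
    and "linear_on_subspace (native_space D L \<rho>) \<nu>"
    and "continuous_map (weak_star_topology (native_space D L \<rho>) (predual L N0 \<phi>)) euclidean \<nu>"
    and "\<forall>q1\<in>null_space D L \<rho>. \<forall>q2\<in>null_space D L \<rho>. \<nu> q1 = \<nu> q2 \<longleftrightarrow> q1 = q2"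
    and "\<exists>f\<in>native_space D L \<rho>. \<nu> f = y"
  shows "\<forall>s. s extreme_point_of interpolation_solutions D L \<rho> \<nu> y \<longrightarrow>
    nonuniform_spline D L \<rho> s \<and>
    (\<exists>(K::nat) (a :: nat \<Rightarrow> real) (x :: nat \<Rightarrow> real^'d) (b :: nat \<Rightarrow> real).
       K + N0 \<le> CARD('m) \<and>
       s = fun_distr (\<lambda>t. (\<Sum>k=1..K. a k * \<rho> (t - x k)) + (\<Sum>n=1..N0. b n * p n t)))"
proof (intro allI impI)
  fix s assume s: "s extreme_point_of interpolation_solutions D L \<rho> \<nu> y"
  let ?n = "growth_order \<rho>"
  have L: "linear_on_subspace D L" and D: "subspace D"
    using assms(1) by (auto simp: spline_admissible_def linear_on_subspace_def)
  have basis: "null_space_basis D L \<rho> N0 p" using assms(2) by (simp add: biorthogonal_system_def)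
  have relation: "\<exists>c. (\<exists>i\<in>I. c i \<noteq> 0) \<and> (\<Sum>i\<in>I. c i *\<^sub>R u i) = 0"
    if "finite I" "u ` I \<subseteq> fragments (L s)" "CARD('m) < card I + N0" for I :: "nat set" and u
    using extreme_point_fragments_relation[OF L basis assms(3,4) s that] .
  \<comment> \<open>the empty family satisfies no nontrivial relation\<close>
  have N0: "N0 \<le> CARD('m)" using relation[of "{}"] by fastforce
  have dep: "fragments_dependent (CARD('m) - N0) (L s)"
    unfolding fragments_dependent_def using N0 relation by auto
  have "s \<in> native_space D L \<rho>"
    using s by (auto simp: extreme_point_of_def interpolation_solutions_def is_arg_min_def)
  then have sD: "s \<in> D" and sL: "s \<in> fun_distr ` L_inf (real ?n)" and "M_norm (L s) < \<infinity>"
    by (auto simp: native_space_def)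
  then obtain Z \<alpha> where Z: "finite Z" "card Z \<le> CARD('m) - N0" "L s = (\<Sum>z\<in>Z. \<alpha> z *\<^sub>R dirac z)"
    using sum_of_diracs_if_fragments_dependent[OF _ dep] by blast
  define K where "K = card Z"
  obtain x where x: "bij_betw x {1..K} Z"
    using ex_bij_betw_nat_finite_1[OF Z(1)] by (auto simp: K_def)
  define a where "a k = \<alpha> (x k)" for k
  have Ls: "L s = (\<Sum>k=1..K. a k *\<^sub>R dirac (x k))"
    unfolding Z(3) a_def by (rule sum.reindex_bij_betw[OF x, symmetric])
  have KN: "K + N0 \<le> CARD('m)" using Z(2) N0 by (simp add: K_def)

  have \<rho>: "\<rho> \<in> L_inf (real ?n)"
  proof -
    have "\<exists>n. \<rho> \<in> L_inf (real n)"
      using assms(1) by (simp add: spline_admissible_def slow_growth_def)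
    then show ?thesis unfolding growth_order_def by (rule LeastI_ex)
  qed
  have green: "shift z (fun_distr \<rho>) \<in> D" "L (shift z (fun_distr \<rho>)) = dirac z"
    "shift z (fun_distr \<rho>) = fun_distr (\<lambda>t. \<rho> (t - z))" for z
    using assms(1) by (auto simp: spline_admissible_def shift_dirac fun_distr_shift[OF \<rho>])
  \<comment> \<open>the combination of shifted Green's functions with the same image under \<open>L\<close> as \<open>s\<close>\<close>
  let ?g = "\<Sum>k=1..K. a k *\<^sub>R shift (x k) (fun_distr \<rho>)"
  have g: "?g \<in> D" "L ?g = L s"
    using linear_on_subspace_sum[where I = "{1..K}" and x = "\<lambda>k. shift (x k) (fun_distr \<rho>)" and c = a,
        OF L green(1)]
    by (simp_all add: green(2) Ls)
  have gL: "?g \<in> fun_distr ` L_inf (real ?n)"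
    using \<rho> by (intro subspace_sum subspace_scale subspace_fun_distr_L_inf)
      (auto simp: green(3) intro!: imageI L_inf_shift)
  have "s - ?g \<in> null_space D L \<rho>"
  proof -
    have "s - ?g = s + (-1) *\<^sub>R ?g" by simp
    then have "L (s - ?g) = 0"
      using linear_on_subspace_add(2)[OF L sD, of "(-1) *\<^sub>R ?g"] linear_on_subspace_scale[OF L g(1), of "-1"] g(2)
      by simp
    then show ?thesis
      using subspace_diff[OF D sD g(1)] subspace_diff[OF subspace_fun_distr_L_inf sL gL]
      by (simp add: null_space_def)
  qed
  then have "s - ?g \<in> span ((\<lambda>n. fun_distr (p n)) ` {1..N0})"
    using basis by (simp add: null_space_basis_def)
  then obtain b where b: "s - ?g = (\<Sum>n=1..N0. b n *\<^sub>R fun_distr (p n))"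
    using span_family[of "{1..N0}" "\<lambda>n. fun_distr (p n)"] basis by (auto simp: null_space_basis_def)
  have p: "p n \<in> L_inf (real ?n)" if "n \<in> {1..N0}" for n using basis that by (simp add: null_space_basis_def)
  have "s = ?g + (\<Sum>n=1..N0. b n *\<^sub>R fun_distr (p n))" using b by (simp add: algebra_simps)
  also have "?g = fun_distr (\<lambda>t. \<Sum>k=1..K. a k * \<rho> (t - x k))"
    by (simp add: green(3) fun_distr_sum[of _ _ ?n] fun_distr_scale[of _ ?n] L_inf_scale L_inf_shift \<rho>)
  also have "(\<Sum>n=1..N0. b n *\<^sub>R fun_distr (p n)) = fun_distr (\<lambda>t. \<Sum>n=1..N0. b n * p n t)"
  proof -
    have "fun_distr (\<lambda>t. \<Sum>n=1..N0. b n * p n t) = (\<Sum>n=1..N0. fun_distr (\<lambda>t. b n * p n t))"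
      by (rule fun_distr_sum[of _ _ ?n], simp, intro L_inf_scale p)
    also have "\<dots> = (\<Sum>n=1..N0. b n *\<^sub>R fun_distr (p n))"
      by (intro sum.cong refl fun_distr_scale[of _ ?n] p)
    finally show ?thesis by (rule sym)
  qed
  also have "fun_distr (\<lambda>t. \<Sum>k=1..K. a k * \<rho> (t - x k)) + fun_distr (\<lambda>t. \<Sum>n=1..N0. b n * p n t)
      = fun_distr (\<lambda>t. (\<Sum>k=1..K. a k * \<rho> (t - x k)) + (\<Sum>n=1..N0. b n * p n t))"
    using p \<rho> by (intro fun_distr_add[symmetric, of _ ?n] L_inf_sum L_inf_scale L_inf_shift) auto
  finally have form: "s = fun_distr (\<lambda>t. (\<Sum>k=1..K. a k * \<rho> (t - x k)) + (\<Sum>n=1..N0. b n * p n t))" .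

  \<comment> \<open>finitely many knots, padded by weights 0\<close>
  have "((\<lambda>k. (if k \<in> {1..K} then a k else 0) * schwartz_fun \<psi> (x k)) has_sum apply_distr (L s) \<psi>) UNIV" for \<psi>
    by (rule has_sum_finite_neutralI[of "{1..K}"])
       (auto simp: Ls sum_tempered_apply scaleR_tempered.rep_eq dirac.rep_eq)
  then have "nonuniform_spline D L \<rho> s"
    using sD sL unfolding nonuniform_spline_def
    by (intro conjI exI[of _ "\<lambda>k. if k \<in> {1..K} then a k else 0"] exI[of _ x] allI)
  with form KN show "nonuniform_spline D L \<rho> s \<and>
      (\<exists>(K::nat) (a :: nat \<Rightarrow> real) (x :: nat \<Rightarrow> real^'d) (b :: nat \<Rightarrow> real).
       K + N0 \<le> CARD('m) \<and>
       s = fun_distr (\<lambda>t. (\<Sum>k=1..K. a k * \<rho> (t - x k)) + (\<Sum>n=1..N0. b n * p n t)))"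
    by blast
qed

end
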